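(* With $Q:=q^{71}$, the following hold: $$2q^3E(q)E(Q)=(3,1,6)-(4,3,5),$$ $$2qE(q)E(Q)U(1,71,q)^2=(3,1,6)-(4,3,5)-(2,1,9)+(1,1,18),$$ $$2q^2E(q)E(Q)U(1,71,q)=(2,1,9)-(3,1,6),$$ $$2qU(1,71,q^2)=-2q^3+\kappa(q)\kappa(Q)-\kappa(-q)\kappa(-Q)-2q^9\frac{1}{\kappa(-q^2)\kappa(-Q^2)},$$ $$\big((3,1,6)-(4,3,5)-(2,1,9)+(1,1,18)\big)\big((3,1,6)-(4,3,5)\big)=\big((2,1,9)-(3,1,6)\big)^2.$$
   Context: Let $|q|<1$, $(a;q)_\infty=\prod_{k\ge0}(1-aq^k)$, $(a;q)_n=\prod_{k=0}^{n-1}(1-aq^k)$. $G(q)=\sum_{n\ge0}\frac{q^{n^2}}{(q;q)_n}$, $H(q)=\sum_{n\ge0}\frac{q^{n(n+1)}}{(q;q)_n}$. For positive integers $r,s$, $U(r,s,q)=G(q^r)G(q^s)+q^{(s+r)/5}H(q^r)H(q^s)$ if $s+r\equiv0\pmod5$ and $U(r,s,q)=H(q^r)G(q^s)-q^{(s-r)/5}G(q^r)H(q^s)$ if $s-r\equiv0\pmod5$; $U(r,s,x)$ denotes this expression with $q$ replaced by $x$. $E(q)=(q;q)_\infty$, $\kappa(q)=(-q;q^2)_\infty$. For integers $a,b,c$ with $a,c>0$, $b^2-4ac<0$, $(a,b,c)$ denotes $\sum_{n,m=-\infty}^{\infty}q^{an^2+bnm+cm^2}$. *)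

theory Defs
  imports "HOL-Analysis.Analysis"
begin

definition qpoch :: "complex \<Rightarrow> complex \<Rightarrow> nat \<Rightarrow> complex" where
  "qpoch a q n = (\<Prod>k<n. 1 - a * q ^ k)"

definition qpoch_inf :: "complex \<Rightarrow> complex \<Rightarrow> complex" where
  "qpoch_inf a q = (\<Prod>k. 1 - a * q ^ k)"

definition RR_G :: "complex \<Rightarrow> complex" where
  "RR_G q = (\<Sum>n. q ^ (n\<^sup>2) / qpoch q q n)"

definition RR_H :: "complex \<Rightarrow> complex" where
  "RR_H q = (\<Sum>n. q ^ (n * (n + 1)) / qpoch q q n)"

text \<open>
  The parameters are positive integers. The exponent \<open>(s - r) / 5\<close> may be negative, hence
  the integer power. If 5 divides both parameters, the first clause takes precedence; if it divides
  neither their sum nor their difference, the value is unspecified.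
\<close>
definition RR_U :: "nat \<Rightarrow> nat \<Rightarrow> complex \<Rightarrow> complex" where
  "RR_U r s q =
     (if 5 dvd s + r
      then RR_G (q ^ r) * RR_G (q ^ s) + q ^ ((s + r) div 5) * RR_H (q ^ r) * RR_H (q ^ s)
      else if 5 dvd int s - int r
      then RR_H (q ^ r) * RR_G (q ^ s)
             - q powi ((int s - int r) div 5) * RR_G (q ^ r) * RR_H (q ^ s)
      else undefined)"

definition euler_E :: "complex \<Rightarrow> complex" where
  "euler_E q = qpoch_inf q q"

definition kappa :: "complex \<Rightarrow> complex" where
  "kappa q = qpoch_inf (- q) (q\<^sup>2)"

text \<open>
  The theta series of the binary form \<open>(a, b, c)\<close> at \<open>q\<close>, meant for positive definite forms
  (\<open>a, c > 0\<close> and \<open>b\<^sup>2 - 4 a c < 0\<close>), for which all exponents are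
  nonnegative and the double series converges absolutely whenever \<open>norm q < 1\<close>.
\<close>
definition theta_form :: "int \<Rightarrow> int \<Rightarrow> int \<Rightarrow> complex \<Rightarrow> complex" where
  "theta_form a b c q =
     (\<Sum>\<^sub>\<infinity>(n, m)\<in>(UNIV :: (int \<times> int) set). q powi (a * n\<^sup>2 + b * n * m + c * m\<^sup>2))"

end

theory Submission
  imports Defs
begin

text \<open>
  Write \<open>e = E(q) E(q\<^sup>7\<^sup>1)\<close>. By the pentagonal number theorem and the Rogers--Ramanujan identities,
  \<open>e\<close> and \<open>e U\<close> are sums of \<open>r\<close> to the power \<open>x\<^sup>2 + 71 y\<^sup>2\<close> over all integers \<open>x, y\<close>
  with weights that are products of characters modulo 12 and 20, where \<open>r\<close> is a root of \<open>q\<close>. A form \<open>(a, b, c)\<close> of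
  discriminant -71 has the same shape, its weight being the indicator of \<open>x = b y\<close> modulo \<open>2a\<close>. Choosing
  representatives with \<open>a = 6\<close> and \<open>a = 10\<close>, the first and third identities hold because the weights
  agree pointwise. For the second one, representatives with \<open>a = 30\<close> express the combination of forms
  through the components of the 5-dissection of \<open>E\<close>, which are known in terms of \<open>G\<close> and \<open>H\<close>, and the result
  is \<open>e U\<^sup>2\<close> because \<open>G(q) H(q) = E(q\<^sup>5) / E(q)\<close>. The fourth identity, multiplied by \<open>E(q\<^sup>2) E(q\<^sup>1\<^sup>4\<^sup>2)\<close>,
  is linear in theta series and amounts to the action of the Hecke operator at 2 on them. The last
  identity is the relation \<open>(e U\<^sup>2) e = (e U)\<^sup>2\<close>.
\<close>

section \<open>Infinite sums over the integers\<close>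

text \<open>Summability of complex families is absolute, so the product family is summable on the
  rectangle and may be summed row by row. Products of one-variable series become two-variable series
  in this way.\<close>

lemma has_sum_product_complex:
  fixes f :: "'a \<Rightarrow> complex" and g :: "'b \<Rightarrow> complex"
  assumes f: "(f has_sum s) A" and g: "(g has_sum t) B"
  shows "((\<lambda>(x, y). f x * g y) has_sum s * t) (A \<times> B)"
proof -
  have fa: "(\<lambda>x. norm (f x)) summable_on A" and ga: "(\<lambda>x. norm (g x)) summable_on B"
    using f g has_sum_imp_summable summable_on_iff_abs_summable_on_complex by blast+
  have "(\<lambda>p. norm (f (fst p) * g (snd p))) summable_on (A \<times> B)"
  proof (subst Infinite_Sum.abs_summable_on_Sigma_iff, intro conjI ballI)
    show "(\<lambda>y. norm (f (fst (x, y)) * g (snd (x, y)))) summable_on B" for x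
      using summable_on_cmult_right[OF ga, of "norm (f x)"] by (simp add: norm_mult)
    have "(\<lambda>x. norm (norm (f x) * infsum (\<lambda>y. norm (g y)) B)) summable_on A"
      using summable_on_cmult_left[OF fa, of "infsum (\<lambda>y. norm (g y)) B"]
      by (simp add: norm_mult infsum_nonneg)
    then show "(\<lambda>x. norm (infsum (\<lambda>y. norm (f (fst (x, y)) * g (snd (x, y)))) B)) summable_on A"
      by (simp add: norm_mult infsum_cmult_right')
  qed
  then have summ: "(\<lambda>(x, y). f x * g y) summable_on (A \<times> B)"
    by (simp add: abs_summable_summable case_prod_unfold)
  show ?thesis
  proof (rule has_sum_SigmaI[OF _ _ summ])
    show "((\<lambda>y. case (x, y) of (x, y) \<Rightarrow> f x * g y) has_sum f x * t) B" for x
      using has_sum_cmult_right[OF g] by simp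
    show "((\<lambda>x. f x * t) has_sum s * t) A"
      using has_sum_cmult_left[OF f] by simp
  qed
qed

lemma has_sum_minus:
  fixes f g :: "'a \<Rightarrow> complex"
  assumes "(f has_sum s) A" and "(g has_sum t) A"
  shows "((\<lambda>x. f x - g x) has_sum s - t) A"
  using has_sum_add[OF assms(1) has_sum_uminusI[OF assms(2)]] by simp

lemma infsum_minus:
  fixes f g :: "'a \<Rightarrow> complex"
  assumes "f summable_on A" and "g summable_on A"
  shows "(\<Sum>\<^sub>\<infinity>x\<in>A. f x - g x) = infsum f A - infsum g A"
  using assms by (intro infsumI has_sum_minus has_sum_infsum)

lemma summable_on_bounded_mult:
  fixes f c :: "'a \<Rightarrow> complex"
  assumes "f summable_on A" and "\<And>x. x \<in> A \<Longrightarrow> norm (c x) \<le> K"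
  shows "(\<lambda>x. c x * f x) summable_on A"
proof -
  have "(\<lambda>x. norm (of_real K * f x)) summable_on A"
    using summable_on_cmult_right[OF assms(1), of "of_real K"]
    unfolding summable_on_iff_abs_summable_on_complex .
  then have "(\<lambda>x. norm (c x * f x)) summable_on A"
  proof (rule Infinite_Sum.abs_summable_on_comparison_test)
    fix x assume "x \<in> A"
    then have "norm (c x) \<le> \<bar>K\<bar>" using assms(2)[of x] by linarith
    then show "norm (c x * f x) \<le> norm (of_real K * f x)"
      by (simp add: norm_mult mult_right_mono)
  qed
  then show ?thesis by (rule abs_summable_summable)
qed

text \<open>The ratio of consecutive terms is \<open>x * q ^ n\<close>, which tends to 0 however
  large x is.\<close>

lemma summable_on_nat_gauss:
  fixes q x :: complex
  assumes "norm q < 1"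
  shows "(\<lambda>n::nat. norm (x ^ n * q ^ (n * (n - 1) div 2))) summable_on UNIV"
proof -
  have "(\<lambda>n. norm (x * q ^ n)) \<longlonglongrightarrow> 0"
    using assms by (intro tendsto_norm_zero tendsto_mult_right_zero LIMSEQ_power_zero)
  then have "eventually (\<lambda>n. norm (x * q ^ n) < 1 / 2) sequentially"
    by (rule order_tendstoD) simp
  then obtain N where N: "\<And>n. n \<ge> N \<Longrightarrow> norm (x * q ^ n) < 1 / 2"
    by (auto simp: eventually_sequentially)
  have "summable (\<lambda>n. norm (x ^ n * q ^ (n * (n - 1) div 2)))"
  proof (rule summable_ratio_test[of "1/2" N])
    fix n assume n: "n \<ge> N"
    have "Suc n * (Suc n - 1) div 2 = n * (n - 1) div 2 + n"
    proof -
      have "even (n * (n - 1))" by (cases n) auto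
      moreover have "Suc n * (Suc n - 1) = n * (n - 1) + 2 * n"
        by (cases n) (simp_all add: algebra_simps)
      ultimately show ?thesis by presburger
    qed
    then have "x ^ Suc n * q ^ (Suc n * (Suc n - 1) div 2)
        = (x * q ^ n) * (x ^ n * q ^ (n * (n - 1) div 2))"
      by (simp only: power_add power_Suc) (simp add: algebra_simps)
    then show "norm (norm (x ^ Suc n * q ^ (Suc n * (Suc n - 1) div 2)))
        \<le> 1 / 2 * norm (norm (x ^ n * q ^ (n * (n - 1) div 2)))"
      using mult_right_mono[OF less_imp_le[OF N[OF n]], of "norm (x ^ n * q ^ (n * (n - 1) div 2))"]
      by (simp only: norm_mult[of "x * q ^ n"] real_norm_def abs_norm_cancel norm_ge_zero abs_mult)
  qed simp
  then show ?thesis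
    by (intro norm_summable_imp_summable_on) (simp add: summable_norm_cancel)
qed

text \<open>The binomial coefficient "n over 2" extended to negative n. Exponents
  \<open>A * tri n + B * n\<close> involve no division, and identities between them follow linearly
  from \<open>two_tri\<close>.\<close>

definition tri :: "int \<Rightarrow> int" where
  "tri n = n * (n - 1) div 2"

lemma two_tri: "2 * tri n = n * (n - 1)"
  unfolding tri_def by simp

lemma tri_of_nat: "tri (int n) = int (n * (n - 1) div 2)"
proof -
  have "int (n * (n - 1)) = int n * (int n - 1)"
    by (cases n) (simp_all add: algebra_simps)
  then show ?thesis unfolding tri_def by (metis zdiv_int of_nat_numeral)
qed

lemma tri_uminus: "tri (- n) = tri n + n"
  using two_tri[of n] two_tri[of "- n"] by (simp add: algebra_simps)

lemma tri_add: "tri (m + n) = tri m + tri n + m * n"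
  using two_tri[of m] two_tri[of n] two_tri[of "m + n"] by (simp add: algebra_simps)

lemma summable_on_int_gauss:
  fixes q x :: complex
  assumes "norm q < 1" "q \<noteq> 0" "x \<noteq> 0"
  shows "(\<lambda>n::int. x powi n * q powi tri n) summable_on UNIV"
proof -
  let ?f = "\<lambda>n::int. x powi n * q powi tri n"
  have pos: "?f (int n) = x ^ n * q ^ (n * (n - 1) div 2)" for n
    by (simp only: tri_of_nat power_int_of_nat)
  \<comment> \<open>Since \<open>tri (- n) = tri n + n\<close>, the negative half is again a
    one-sided Gauss series, with \<open>q / x\<close> in place of \<open>x\<close>.\<close>
  have neg: "?f (- int n) = (q / x) ^ n * q ^ (n * (n - 1) div 2)" for n
  proof -
    have "tri (- int n) = int (n * (n - 1) div 2 + n)"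
      by (simp add: tri_uminus tri_of_nat)
    then show ?thesis
      using assms by (simp only: power_int_of_nat)
        (simp add: power_add power_int_minus power_divide field_simps)
  qed
  have "?f summable_on range int"
    unfolding summable_on_reindex[OF inj_of_nat] o_def pos
    by (rule abs_summable_summable[OF summable_on_nat_gauss[OF assms(1)]])
  moreover have "?f summable_on range (\<lambda>n. - int n)"
    by (subst summable_on_reindex)
      (auto simp only: o_def neg inj_on_def neg_equal_iff_equal of_nat_eq_iff
        intro!: abs_summable_summable[OF summable_on_nat_gauss[OF assms(1)]])
  ultimately have "?f summable_on (range int \<union> range (\<lambda>n. - int n))"
    by (rule summable_on_union)
  also have "range int \<union> range (\<lambda>n. - int n) = UNIV"
  proof -
    have "n \<in> range int \<union> range (\<lambda>n. - int n)" for n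
      by (cases n rule: int_cases2) auto
    then show ?thesis by blast
  qed
  finally show ?thesis .
qed

lemma summable_on_int_quadratic:
  fixes q :: complex
  assumes q: "norm q < 1" "q \<noteq> 0" and A: "A > 0"
  shows "(\<lambda>n. q powi (A * tri n + B * n)) summable_on UNIV"
proof -
  have "(\<lambda>n. (q powi B) powi n * (q ^ nat A) powi tri n) summable_on UNIV"
    using q A by (intro summable_on_int_gauss) (auto simp: norm_power power_less_one_iff)
  moreover have "(q powi B) powi n * (q ^ nat A) powi tri n = q powi (A * tri n + B * n)" for n
    using q A by (simp add: power_int_add power_int_mult flip: power_int_of_nat)
  ultimately show ?thesis by simp
qed

text \<open>Dominated convergence: the terms with m > 0 carry a factor r^k, so only the term at 0
  survives as k grows. This supplies the limits needed for \<open>cauchy_sum\<close> and for Euler's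
  series.\<close>

lemma tendsto_infsum_minus_head:
  fixes c :: "nat \<Rightarrow> int \<Rightarrow> complex" and g :: "int \<Rightarrow> complex"
  assumes c: "\<And>k. c k summable_on UNIV" and g: "g summable_on UNIV" and r: "0 \<le> r" "r < 1"
    and neg: "\<And>k m. m < 0 \<Longrightarrow> c k m = 0" and pos: "\<And>k m. m > 0 \<Longrightarrow> norm (c k m) \<le> r ^ k * norm (g m)"
  shows "(\<lambda>k. (\<Sum>\<^sub>\<infinity>m. c k m) - c k 0) \<longlonglongrightarrow> 0"
proof (rule tendsto_norm_zero_cancel, rule tendsto_sandwich[OF _ _ tendsto_const])
  define M where "M = (\<Sum>\<^sub>\<infinity>m\<in>- {0}. norm (g m))"
  have "(\<lambda>m. norm (g m)) summable_on - {0}"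
    using g summable_on_iff_abs_summable_on_complex summable_on_subset_banach by blast
  then have gM: "((\<lambda>m. norm (g m)) has_sum M) (- {0})"
    unfolding M_def by simp
  show "\<forall>\<^sub>F k in sequentially. norm ((\<Sum>\<^sub>\<infinity>m. c k m) - c k 0) \<le> r ^ k * M"
  proof (intro always_eventually allI)
    fix k
    have ck: "c k summable_on - {0}"
      using c summable_on_subset_banach by blast
    have "(\<Sum>\<^sub>\<infinity>m. c k m) = c k 0 + (\<Sum>\<^sub>\<infinity>m\<in>- {0}. c k m)"
      using infsum_insert[OF ck, of 0] by (simp add: insert_UNIV Compl_eq_Diff_UNIV insert_absorb)
    moreover have "norm (\<Sum>\<^sub>\<infinity>m\<in>- {0}. c k m) \<le> r ^ k * M"
    proof (rule norm_infsum_le)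
      show "(c k has_sum (\<Sum>\<^sub>\<infinity>m\<in>- {0}. c k m)) (- {0})"
        using ck by simp
      show "((\<lambda>m. r ^ k * norm (g m)) has_sum r ^ k * M) (- {0})"
        using gM by (rule has_sum_cmult_right)
      show "norm (c k m) \<le> r ^ k * norm (g m)" if "m \<in> - {0}" for m
        using that neg[of m k] pos[of m k] r by (cases "m > 0") auto
    qed
    ultimately show "norm ((\<Sum>\<^sub>\<infinity>m. c k m) - c k 0) \<le> r ^ k * M" by simp
  qed
  show "(\<lambda>k. r ^ k * M) \<longlonglongrightarrow> 0"
    using r by (intro tendsto_mult_left_zero LIMSEQ_power_zero) simp
qed simp

lemma infsum_int_shift:
  fixes f :: "int \<Rightarrow> complex"
  shows "(\<Sum>\<^sub>\<infinity>n. f (n + k)) = (\<Sum>\<^sub>\<infinity>n. f n)"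
  by (rule infsum_reindex_bij_witness[of _ "\<lambda>n. n - k" "\<lambda>n. n + k"]) auto

lemma infsum_int_reflect:
  fixes f :: "int \<Rightarrow> complex"
  shows "(\<Sum>\<^sub>\<infinity>n. f (k - n)) = (\<Sum>\<^sub>\<infinity>n. f n)"
  by (rule infsum_reindex_bij_witness[of _ "\<lambda>n. k - n" "\<lambda>n. k - n"]) auto

section \<open>\<open>q\<close>-Pochhammer symbols\<close>

lemma convergent_prod_qpoch:
  fixes a q :: complex
  assumes "norm q < 1"
  shows "convergent_prod (\<lambda>k. 1 - a * q ^ k)"
proof -
  have "summable (\<lambda>i. norm (a * q ^ i))"
    unfolding norm_mult norm_power using assms by (intro summable_mult summable_geometric) simp
  then have "abs_convergent_prod (\<lambda>k. 1 - a * q ^ k)"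
    by (intro summable_imp_abs_convergent_prod) (simp add: norm_minus_commute)
  then show ?thesis by (rule abs_convergent_prod_imp_convergent_prod)
qed

lemma qpoch_LIMSEQ:
  assumes "norm q < 1"
  shows "qpoch a q \<longlonglongrightarrow> qpoch_inf a q"
  using convergent_prod_LIMSEQ[OF convergent_prod_qpoch[OF assms, of a]]
  unfolding qpoch_inf_def qpoch_def LIMSEQ_lessThan_iff_atMost .

lemma power_Suc_neq_1:
  fixes q :: complex
  assumes "norm q < 1"
  shows "1 - q * q ^ k \<noteq> 0"
proof
  assume "1 - q * q ^ k = 0"
  then have "norm (q ^ Suc k) = 1" by simp
  moreover have "norm (q ^ Suc k) < 1"
    using assms by (simp add: norm_power power_less_one_iff del: power_Suc)
  ultimately show False by simp
qed

lemma qpoch_nonzero: "norm q < 1 \<Longrightarrow> qpoch q q n \<noteq> 0"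
  unfolding qpoch_def using power_Suc_neq_1 by (simp del: eq_iff_diff_eq_0)

lemma euler_E_nonzero: "norm q < 1 \<Longrightarrow> euler_E q \<noteq> 0"
  unfolding euler_E_def qpoch_inf_def
  by (intro prodinf_nonzero convergent_prod_qpoch power_Suc_neq_1)

text \<open>The exponents 1, ..., m n of the factors are sorted by residue class modulo m. Class 0
  is represented by j = m, so that it gives \<open>euler_E (q ^ m)\<close> in the limit.\<close>

lemma qpoch_multisection:
  "qpoch q q (m * n) = (\<Prod>j=1..m. qpoch (q ^ j) (q ^ m) n)"
proof (induction n)
  case (Suc n)
  have "qpoch q q (m * Suc n) = qpoch q q (m * n) * (\<Prod>j=1..m. 1 - q ^ (m * n + j))"
  proof -
    have "qpoch q q (m * Suc n) = qpoch q q (m * n) * (\<Prod>k=m * n..<m * n + m. 1 - q * q ^ k)"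
      unfolding qpoch_def lessThan_atLeast0
      by (subst prod.atLeastLessThan_concat) (simp_all add: add.commute)
    also have "(\<Prod>k=m * n..<m * n + m. 1 - q * q ^ k) = (\<Prod>j=1..m. 1 - q ^ (m * n + j))"
      by (rule prod.reindex_bij_witness[of _ "\<lambda>j. m * n + j - 1" "\<lambda>k. k + 1 - m * n"])
        (auto simp: power_Suc[symmetric] simp del: power_Suc intro!: arg_cong[where f = "\<lambda>k. q ^ k"])
    finally show ?thesis .
  qed
  also have "\<dots> = (\<Prod>j=1..m. qpoch (q ^ j) (q ^ m) n * (1 - q ^ j * (q ^ m) ^ n))"
    unfolding Suc.IH prod.distrib by (simp add: power_add power_mult mult.commute[of "q ^ _"])
  finally show ?case by (simp add: qpoch_def)
qed (simp add: qpoch_def)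

lemma euler_E_multisection:
  assumes "norm q < 1" "m > 0"
  shows "euler_E q = (\<Prod>j=1..m. qpoch_inf (q ^ j) (q ^ m))"
proof -
  have "norm (q ^ m) < 1"
    using assms by (simp add: norm_power power_less_one_iff)
  then have "(\<lambda>n. \<Prod>j=1..m. qpoch (q ^ j) (q ^ m) n) \<longlonglongrightarrow> (\<Prod>j=1..m. qpoch_inf (q ^ j) (q ^ m))"
    by (intro tendsto_prod qpoch_LIMSEQ)
  moreover have "(\<lambda>n. qpoch q q (m * n)) \<longlonglongrightarrow> euler_E q"
    unfolding euler_E_def
    using LIMSEQ_subseq_LIMSEQ[OF qpoch_LIMSEQ[OF assms(1)], of "\<lambda>n. m * n"] assms(2)
    by (simp add: strict_mono_def o_def)
  ultimately show ?thesis
    unfolding qpoch_multisection using LIMSEQ_unique by blast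
qed

text \<open>Setting \<open>1 / (q;q)\<^sub>k\<close> to zero for negative \<open>k\<close> keeps the recurrence
  \<open>(q;q)\<^sub>k = (1 - q\<^sup>k) (q;q)\<^sub>k\<^sub>-\<^sub>1\<close> valid on all integers, so that all sums below can
  range over all integers.\<close>
definition inv_qfact :: "complex \<Rightarrow> int \<Rightarrow> complex" where
  "inv_qfact q k = (if k < 0 then 0 else 1 / qpoch q q (nat k))"

lemma inv_qfact_rec:
  assumes "norm q < 1" "q \<noteq> 0"
  shows "inv_qfact q (k - 1) = (1 - q powi k) * inv_qfact q k"
proof (cases "k > 0")
  case True
  then obtain n where k: "k = int (Suc n)"
    by (metis gr0_implies_Suc zero_less_imp_eq_int)
  have "qpoch q q (Suc n) = qpoch q q n * (1 - q ^ Suc n)"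
    by (simp add: qpoch_def)
  moreover have "qpoch q q n \<noteq> 0" "1 - q ^ Suc n \<noteq> 0"
    using assms qpoch_nonzero power_Suc_neq_1[of q n] by auto
  moreover have "q powi k = q ^ Suc n" unfolding k power_int_of_nat ..
  ultimately show ?thesis
    unfolding inv_qfact_def k by (simp del: power_Suc add: nat_add_distrib)
next
  case False
  then show ?thesis by (cases "k = 0") (auto simp: inv_qfact_def)
qed

text \<open>The reciprocals converge to \<open>1 / euler_E q\<close>, since the infinite product
  does not vanish. A bound uniform in k lets the \<open>inv_qfact\<close> factors be discarded in
  questions of summability.\<close>

lemma inv_qfact_bounded:
  assumes "norm q < 1"
  obtains K where "\<And>k. norm (inv_qfact q k) \<le> K" "K > 0"
proof -
  have "(\<lambda>n. 1 / qpoch q q n) \<longlonglongrightarrow> 1 / qpoch_inf q q"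
    using assms euler_E_nonzero[OF assms]
    by (intro tendsto_divide qpoch_LIMSEQ) (auto simp: euler_E_def)
  then have "Bseq (\<lambda>n. 1 / qpoch q q n)"
    using convergent_imp_Bseq convergentI by blast
  then obtain K where K: "K > 0" "\<And>n. norm (1 / qpoch q q n) \<le> K"
    by (auto elim: BseqE)
  then have "norm (inv_qfact q k) \<le> K" for k
    by (auto simp: inv_qfact_def)
  then show thesis using K that by blast
qed

section \<open>The Jacobi triple product and the Rogers--Ramanujan identities\<close>

context
  fixes q :: complex
  assumes q1: "norm q < 1" and q0: "q \<noteq> 0"
begin

lemma summable_on_inv_qfact2:
  assumes "f summable_on A"
  shows "(\<lambda>m. f m * (inv_qfact q (k m) * inv_qfact q (l m))) summable_on A"
proof -
  obtain K where K: "\<And>k. norm (inv_qfact q k) \<le> K" "K > 0"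
    using inv_qfact_bounded[OF q1] by blast
  have "(\<lambda>m. (inv_qfact q (k m) * inv_qfact q (l m)) * f m) summable_on A"
    by (rule summable_on_bounded_mult[OF assms, where K = "K * K"])
      (use K in \<open>auto simp: norm_mult less_imp_le intro!: mult_mono\<close>)
  then show ?thesis by (simp add: mult.commute)
qed

section \<open>Cauchy's identity for 1 / E(q), with an integer parameter k\<close>

definition cauchy_term :: "int \<Rightarrow> int \<Rightarrow> complex" where
  "cauchy_term k m = q powi (m\<^sup>2 + k * m) * (inv_qfact q m * inv_qfact q (m + k))"

lemma summable_on_gauss_square: "(\<lambda>m. q powi (m\<^sup>2 + k * m)) summable_on UNIV"
proof -
  have "m\<^sup>2 + k * m = 2 * tri m + (k + 1) * m" for m
    using two_tri[of m] by (simp add: power2_eq_square algebra_simps)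
  then show ?thesis using summable_on_int_quadratic[OF q1 q0, of 2 "k + 1"] by simp
qed

lemma summable_on_cauchy_term: "cauchy_term k summable_on UNIV"
  unfolding cauchy_term_def by (intro summable_on_inv_qfact2 summable_on_gauss_square)

text \<open>By \<open>inv_qfact_rec\<close> every term is a multiple of
  \<open>u * inv_qfact q m * v\<close>, and on both sides the cofactor is 1 - q^m - q^(m+k+1). The
  shift to m - 1 disappears on summing over all integers.\<close>

lemma cauchy_term_rec:
  "cauchy_term k m - cauchy_term (k + 1) m
     = q powi (k + 1) * (cauchy_term (k + 2) (m - 1) - cauchy_term (k + 1) m)"
proof -
  define u where "u = q powi (m\<^sup>2 + k * m)"
  define v where "v = inv_qfact q (m + k + 1)"
  have 1: "cauchy_term k m = u * (inv_qfact q m * ((1 - q powi m * q powi (k + 1)) * v))"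
    unfolding cauchy_term_def u_def v_def
    using inv_qfact_rec[OF q1 q0, of "m + (k + 1)"] q0 unfolding power_int_add[OF disjI1[OF q0], of m]
    by (simp add: add.assoc)
  have 2: "cauchy_term (k + 1) m = u * q powi m * (inv_qfact q m * v)"
    unfolding cauchy_term_def u_def v_def using q0 by (simp add: power_int_add algebra_simps)
  have "(m - 1)\<^sup>2 + (k + 2) * (m - 1) = m\<^sup>2 + k * m - (k + 1)"
    by (simp add: power2_eq_square algebra_simps)
  then have "q powi (k + 1) * q powi ((m - 1)\<^sup>2 + (k + 2) * (m - 1)) = u"
    unfolding u_def using q0 by (simp only: power_int_add[OF disjI1[OF q0], symmetric]) simp
  moreover have "m - 1 + (k + 2) = m + k + 1" by simp
  ultimately have 3: "q powi (k + 1) * cauchy_term (k + 2) (m - 1) = u * ((1 - q powi m) * inv_qfact q m * v)"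
    unfolding cauchy_term_def v_def inv_qfact_rec[OF q1 q0, of m] by (simp only: mult.assoc[symmetric])
  show ?thesis
    unfolding right_diff_distrib 3 unfolding 1 2 by (simp add: algebra_simps)
qed

definition cauchy_sum :: "int \<Rightarrow> complex" where
  "cauchy_sum k = (\<Sum>\<^sub>\<infinity>m. cauchy_term k m)"

lemma cauchy_sum_rec:
  "cauchy_sum k - cauchy_sum (k + 1) = - (q powi (k + 1)) * (cauchy_sum (k + 1) - cauchy_sum (k + 2))"
proof -
  have s: "cauchy_term l summable_on UNIV" "(\<lambda>m. cauchy_term l (m - 1)) summable_on UNIV" for l
    using summable_on_cauchy_term[of l]
      summable_on_reindex_bij_betw[OF bij_betwI[of "\<lambda>m. m - 1" UNIV UNIV "\<lambda>m. m + 1"], of "cauchy_term l"]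
    by auto
  have "cauchy_sum k - cauchy_sum (k + 1) = (\<Sum>\<^sub>\<infinity>m. cauchy_term k m - cauchy_term (k + 1) m)"
    unfolding cauchy_sum_def by (simp add: infsum_minus s)
  also have "\<dots> = q powi (k + 1) * ((\<Sum>\<^sub>\<infinity>m. cauchy_term (k + 2) (m + (- 1))) - cauchy_sum (k + 1))"
    unfolding cauchy_term_rec cauchy_sum_def by (simp add: infsum_minus s infsum_cmult_right')
  also have "\<dots> = - (q powi (k + 1)) * (cauchy_sum (k + 1) - cauchy_sum (k + 2))"
    unfolding infsum_int_shift by (simp add: cauchy_sum_def algebra_simps)
  finally show ?thesis .
qed

text \<open>As k grows, only m = 0 remains, with value 1 / (q;q)_k.\<close>

lemma cauchy_sum_nat_tendsto: "(\<lambda>k. cauchy_sum (int k)) \<longlonglongrightarrow> 1 / euler_E q"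
proof -
  obtain K where K: "\<And>k. norm (inv_qfact q k) \<le> K" "K > 0"
    using inv_qfact_bounded[OF q1] by blast
  have "(\<lambda>k. (\<Sum>\<^sub>\<infinity>m. cauchy_term (int k) m) - cauchy_term (int k) 0) \<longlonglongrightarrow> 0"
  proof (rule tendsto_infsum_minus_head)
    show "(\<lambda>m. (of_real (K * K) * q powi (m\<^sup>2 + 0 * m))) summable_on UNIV"
      by (intro summable_on_cmult_right summable_on_gauss_square)
    show "cauchy_term (int k) m = 0" if "m < 0" for k m
      using that by (simp add: cauchy_term_def inv_qfact_def)
    show "norm (cauchy_term (int k) m) \<le> norm q ^ k * norm (of_real (K * K) * q powi (m\<^sup>2 + 0 * m))"
      if "m > 0" for k m
    proof -
      have "norm q powi (int k * m) \<le> norm q powi (int k * 1)"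
        using that q0 q1 by (intro power_int_decreasing mult_left_mono) auto
      then have "norm (q powi (m\<^sup>2 + int k * m)) \<le> norm q ^ k * norm (q powi m\<^sup>2)"
        using q0 by (simp add: power_int_add norm_mult norm_power_int mult.commute mult_right_mono)
      moreover have "norm (inv_qfact q m * inv_qfact q (m + int k)) \<le> K * K"
        using K by (auto simp: norm_mult less_imp_le intro!: mult_mono)
      ultimately have "norm (cauchy_term (int k) m) \<le> (norm q ^ k * norm (q powi m\<^sup>2)) * (K * K)"
        unfolding cauchy_term_def norm_mult[of "q powi _"] by (intro mult_mono) auto
      then show ?thesis
        using K by (simp add: norm_mult algebra_simps)
    qed
  qed (use q1 summable_on_cauchy_term in auto)
  moreover have "cauchy_term (int k) 0 = 1 / qpoch q q k" for k
    by (simp add: cauchy_term_def inv_qfact_def qpoch_def)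
  moreover have "(\<lambda>k. 1 / qpoch q q k) \<longlonglongrightarrow> 1 / euler_E q"
    using euler_E_nonzero[OF q1] unfolding euler_E_def
    by (intro tendsto_divide qpoch_LIMSEQ q1) auto
  ultimately show ?thesis
    unfolding cauchy_sum_def by (auto dest: tendsto_add)
qed

text \<open>The differences \<open>d k\<close> of consecutive sums satisfy \<open>d k = - q\<^sup>k\<^sup>+\<^sup>1 d (k + 1)\<close>; being
  bounded, they vanish.\<close>
lemma cauchy_sum_nat: "cauchy_sum (int k) = 1 / euler_E q"
proof -
  define d where "d k = cauchy_sum (int k) - cauchy_sum (int k + 1)" for k
  have d_rec: "norm (d k) \<le> norm q * norm (d (Suc k))" for k
  proof -
    have "d k = - (q ^ Suc k) * d (Suc k)"
      using cauchy_sum_rec[of "int k"] unfolding d_def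
      by (simp add: add.commute add.left_commute flip: power_int_of_nat)
    then have "norm (d k) = norm q ^ Suc k * norm (d (Suc k))"
      by (simp add: norm_mult norm_power del: power_Suc)
    also have "\<dots> \<le> norm q * norm (d (Suc k))"
      using q1 power_decreasing[of 1 "Suc k" "norm q"] by (intro mult_right_mono) auto
    finally show ?thesis .
  qed
  have d_iter: "norm (d k) \<le> norm q ^ j * norm (d (k + j))" for k j
  proof (induction j)
    case (Suc j)
    have "norm (d k) \<le> norm q ^ j * norm (d (k + j))" by (rule Suc.IH)
    also have "\<dots> \<le> norm q ^ j * (norm q * norm (d (Suc (k + j))))"
      by (intro mult_left_mono d_rec) auto
    finally show ?case by (simp add: mult_ac)
  qed simp
  have "(\<lambda>k. cauchy_sum (int (k + 1))) \<longlonglongrightarrow> 1 / euler_E q"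
    using cauchy_sum_nat_tendsto by (rule LIMSEQ_ignore_initial_segment)
  then have "d \<longlonglongrightarrow> 0"
    using tendsto_diff[OF cauchy_sum_nat_tendsto, of "\<lambda>k. cauchy_sum (int (k + 1))" "1 / euler_E q"]
    unfolding d_def by (simp add: add.commute)
  then have "(\<lambda>j. norm q ^ j * norm (d (j + k))) \<longlonglongrightarrow> 0 * norm (0::complex)" for k
    using q1 by (intro tendsto_mult tendsto_norm LIMSEQ_power_zero LIMSEQ_ignore_initial_segment) auto
  then have "norm (d k) \<le> 0 * norm (0::complex)" for k
    by (rule LIMSEQ_le_const) (use d_iter[of k] in \<open>auto simp: add.commute\<close>)
  then have "d k = 0" for k by simp
  then have "cauchy_sum (int k + 1) = cauchy_sum (int k)" for k by (simp add: d_def)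
  then have const: "cauchy_sum (int k) = cauchy_sum 0" for k
    by (induction k) (auto simp: add.commute)
  have "cauchy_sum 0 = 1 / euler_E q"
    using cauchy_sum_nat_tendsto unfolding const by (simp add: LIMSEQ_const_iff)
  then show ?thesis using const by simp
qed

text \<open>For k = -n, the shift of m by n turns m^2 - n m into m^2 + n m and exchanges the two
  \<open>inv_qfact\<close> factors, which reduces the claim to k = n.\<close>

lemma cauchy_sum_eq: "cauchy_sum k = 1 / euler_E q"
proof (cases k rule: int_cases2)
  case (nonpos n)
  have "cauchy_sum k = (\<Sum>\<^sub>\<infinity>m. cauchy_term k (m + int n))"
    unfolding cauchy_sum_def infsum_int_shift ..
  also have "(\<lambda>m. cauchy_term k (m + int n)) = cauchy_term (int n)"
  proof
    fix m
    have "(m + int n)\<^sup>2 + k * (m + int n) = m\<^sup>2 + int n * m"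
      by (simp add: nonpos power2_eq_square algebra_simps)
    then show "cauchy_term k (m + int n) = cauchy_term (int n) m"
      unfolding cauchy_term_def by (simp add: nonpos mult.commute)
  qed
  finally show ?thesis using cauchy_sum_nat[of n] by (simp add: cauchy_sum_def)
qed (simp add: cauchy_sum_nat)

lemma has_sum_cauchy_term: "(cauchy_term k has_sum 1 / euler_E q) UNIV"
  using has_sum_infsum[OF summable_on_cauchy_term] cauchy_sum_eq by (simp add: cauchy_sum_def)

section \<open>Euler's expansion of (x;q)_inf and the Jacobi triple product\<close>

definition euler_term :: "complex \<Rightarrow> int \<Rightarrow> complex" where
  "euler_term x i = (- x) powi i * q powi tri i * inv_qfact q i"

lemma euler_term_scale: "euler_term (x * y) i = y powi i * euler_term x i"
proof -
  have "- (x * y) = (- x) * y" by simp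
  then show ?thesis unfolding euler_term_def by (simp only: power_int_mult_distrib) (simp add: mult_ac)
qed

lemma summable_on_euler_term:
  assumes "x \<noteq> 0"
  shows "euler_term x summable_on UNIV"
proof -
  obtain K where K: "\<And>k. norm (inv_qfact q k) \<le> K"
    using inv_qfact_bounded[OF q1] by blast
  have "(\<lambda>i. inv_qfact q i * ((- x) powi i * q powi tri i)) summable_on UNIV"
    using assms K q0 q1 by (intro summable_on_bounded_mult[where K = K] summable_on_int_gauss) auto
  then show ?thesis unfolding euler_term_def by (simp add: mult.commute)
qed

text \<open>The functional equation of (x;q)_inf. Coefficientwise, 1 - q^i cancels the last factor
  of (q;q)_i, which leaves the preceding term of the series at \<open>x * q\<close>.\<close>

lemma infsum_euler_term_rec:
  assumes "x \<noteq> 0"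
  shows "(\<Sum>\<^sub>\<infinity>i. euler_term x i) = (1 - x) * (\<Sum>\<^sub>\<infinity>i. euler_term (x * q) i)"
proof -
  have s: "euler_term (x * q) summable_on UNIV" "euler_term x summable_on UNIV"
    using assms q0 by (auto intro: summable_on_euler_term)
  have *: "euler_term x i - euler_term (x * q) i = - x * euler_term (x * q) (i - 1)" for i
  proof -
    have "tri i = tri (i - 1) + (i - 1)"
      using tri_add[of "i - 1" 1] by (simp add: tri_def)
    then have "q powi tri i = q powi (i - 1) * q powi tri (i - 1)"
      using q0 by (simp add: power_int_add)
    moreover have "(- x) powi i = - x * (- x) powi (i - 1)"
      using assms by (simp add: power_int_diff)
    ultimately have "- x * euler_term (x * q) (i - 1) = (1 - q powi i) * euler_term x i"
      unfolding euler_term_scale unfolding euler_term_def inv_qfact_rec[OF q1 q0] by simp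
    then show ?thesis
      unfolding euler_term_scale by (simp add: algebra_simps)
  qed
  have "(\<Sum>\<^sub>\<infinity>i. euler_term x i) - (\<Sum>\<^sub>\<infinity>i. euler_term (x * q) i)
      = (\<Sum>\<^sub>\<infinity>i. euler_term x i - euler_term (x * q) i)"
    by (simp add: infsum_minus s)
  also have "\<dots> = - x * (\<Sum>\<^sub>\<infinity>i. euler_term (x * q) (i + (- 1)))"
    unfolding * by (simp add: infsum_cmult_right' infsum_uminus)
  also have "\<dots> = - x * (\<Sum>\<^sub>\<infinity>i. euler_term (x * q) i)"
    unfolding infsum_int_shift ..
  finally show ?thesis by (simp add: algebra_simps)
qed

text \<open>Iterating the functional equation splits off (x;q)_n, and the remaining series at x q^n
  tends to its term i = 0, which is 1.\<close>

lemma has_sum_euler_term: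
  assumes x: "x \<noteq> 0"
  shows "(euler_term x has_sum qpoch_inf x q) UNIV"
proof -
  let ?F = "\<lambda>x. \<Sum>\<^sub>\<infinity>i. euler_term x i"
  have iter: "?F x = qpoch x q n * ?F (x * q ^ n)" for n
  proof (induction n)
    case (Suc n)
    then show ?case
      using infsum_euler_term_rec[of "x * q ^ n"] x q0 by (simp add: qpoch_def mult_ac)
  qed (simp add: qpoch_def)
  have "(\<lambda>n. ?F (x * q ^ n) - euler_term (x * q ^ n) 0) \<longlonglongrightarrow> 0"
  proof (rule tendsto_infsum_minus_head)
    show "norm (euler_term (x * q ^ n) i) \<le> norm q ^ n * norm (euler_term x i)" if "i > 0" for n i
    proof -
      have "euler_term (x * q ^ n) i = q powi (int n * i) * euler_term x i"
        unfolding euler_term_scale by (simp add: power_int_mult)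
      moreover have "norm q powi (int n * i) \<le> norm q powi (int n * 1)"
        using that q0 q1 by (intro power_int_decreasing mult_left_mono) auto
      ultimately show ?thesis by (simp add: norm_mult norm_power_int mult_right_mono)
    qed
    show "euler_term (x * q ^ n) i = 0" if "i < 0" for n i
      using that by (simp add: euler_term_def inv_qfact_def)
  qed (use q0 q1 x in \<open>auto intro: summable_on_euler_term\<close>)
  moreover have "euler_term y 0 = 1" for y
    by (simp add: euler_term_def inv_qfact_def qpoch_def tri_def)
  ultimately have "(\<lambda>n. ?F (x * q ^ n)) \<longlonglongrightarrow> 1"
    using tendsto_add[OF _ tendsto_const, of _ 0 sequentially 1] by fastforce
  then have "(\<lambda>n. qpoch x q n * ?F (x * q ^ n)) \<longlonglongrightarrow> qpoch_inf x q * 1"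
    by (intro tendsto_mult qpoch_LIMSEQ q1)
  then have "?F x = qpoch_inf x q"
    unfolding iter[symmetric] by (simp add: LIMSEQ_const_iff)
  then show ?thesis
    using has_sum_infsum[OF summable_on_euler_term[OF x]] by simp
qed

text \<open>Euler's series at x and at q/x are multiplied and the double sum is grouped by n = i -
  j. The inner sum over j is Cauchy's sum with parameter n and so contributes the constant 1 /
  E(q).\<close>

lemma jacobi_triple_product:
  assumes x: "x \<noteq> 0"
  shows "((\<lambda>n. (- x) powi n * q powi tri n) has_sum
            qpoch_inf x q * qpoch_inf (q / x) q * euler_E q) UNIV"
proof -
  let ?g = "\<lambda>(n, j). (- x) powi n * q powi tri n * cauchy_term n j"
  have "((\<lambda>(i, j). euler_term x i * euler_term (q / x) j) has_sum
          qpoch_inf x q * qpoch_inf (q / x) q) (UNIV \<times> UNIV)"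
    using x q0 by (intro has_sum_product_complex has_sum_euler_term) auto
  also have "?this \<longleftrightarrow> (?g has_sum qpoch_inf x q * qpoch_inf (q / x) q) (UNIV \<times> UNIV)"
  proof (rule has_sum_reindex_bij_witness[of _ "\<lambda>(n, j). (n + j, j)" "\<lambda>(i, j). (i - j, j)"])
    fix p :: "int \<times> int"
    obtain i j where p: "p = (i, j)" by (cases p)
    have e: "tri i + (tri j + j) = tri (i - j) + (j\<^sup>2 + (i - j) * j)"
      using two_tri[of i] two_tri[of j] two_tri[of "i - j"] by (simp add: algebra_simps power2_eq_square)
    have "(- x) powi i * (- (q / x)) powi j * q powi tri i * q powi tri j
        = (- x) powi (i - j) * q powi (tri i + (tri j + j))"
    proof -
      have "- (q / x) = q / (- x)" by simp
      then show ?thesis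
        using x q0 by (simp only: power_int_divide_distrib) (simp add: power_int_add power_int_diff mult_ac)
    qed
    also have "\<dots> = (- x) powi (i - j) * q powi tri (i - j) * q powi (j\<^sup>2 + (i - j) * j)"
      unfolding e using q0 by (simp add: power_int_add)
    finally show "(case (case p of (i, j) \<Rightarrow> (i - j, j)) of (n, j) \<Rightarrow> (- x) powi n * q powi tri n * cauchy_term n j)
        = (case p of (i, j) \<Rightarrow> euler_term x i * euler_term (q / x) j)"
      unfolding p euler_term_def cauchy_term_def by (simp add: mult_ac)
  qed auto
  finally have "((\<lambda>n. (- x) powi n * q powi tri n * (1 / euler_E q)) has_sum
      qpoch_inf x q * qpoch_inf (q / x) q) UNIV"
  proof (rule has_sum_SigmaD)
    show "((\<lambda>j. ?g (n, j)) has_sum (- x) powi n * q powi tri n * (1 / euler_E q)) UNIV" for n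
      using has_sum_cmult_right[OF has_sum_cauchy_term] by simp
  qed
  from has_sum_cmult_left[OF this, of "euler_E q"] show ?thesis
    using euler_E_nonzero[OF q1] by simp
qed

section \<open>The Bailey pair and the Rogers-Ramanujan identities\<close>

text \<open>Half of a Bailey pair, the other half being \<open>1 / (q;q)\<^sub>n\<close>, relative to both \<open>1\<close> and \<open>q\<close>.\<close>
definition pent :: "int \<Rightarrow> complex" where
  "pent r = (- 1) powi r * q powi (3 * tri r + 2 * r)"

lemma summable_on_pent: "(\<lambda>r. (- 1) powi r * q powi (3 * tri r + B * r)) summable_on UNIV"
  by (rule summable_on_bounded_mult[OF summable_on_int_quadratic[OF q1 q0], where K = 1])
    (auto simp: norm_power_int)

definition pent_sum :: "int \<Rightarrow> complex" where
  "pent_sum n = (\<Sum>\<^sub>\<infinity>r. pent r * (inv_qfact q (n - r) * inv_qfact q (n + r)))"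

definition pent_sum' :: "int \<Rightarrow> complex" where
  "pent_sum' n = (\<Sum>\<^sub>\<infinity>r. pent r * (inv_qfact q (n - r) * inv_qfact q (n + r + 1)))"

text \<open>The summands differ by a multiple of \<open>?f\<close>. The reflection r -> -1 - r
  exchanges the two \<open>inv_qfact\<close> factors of \<open>?f\<close> and reverses its sign, so
  \<open>?f\<close> sums to 0.\<close>

lemma pent_sum_eq_pent_sum': "pent_sum n = pent_sum' n"
proof -
  let ?f = "\<lambda>r. (- 1) powi r * q powi (3 * tri r + 3 * r)
              * (inv_qfact q (n - r) * inv_qfact q (n + r + 1))"
  have "?f r = - ?f (- 1 - r)" for r
  proof -
    have "3 * tri (- 1 - r) + 3 * (- 1 - r) = 3 * tri r + 3 * r"
      using two_tri[of r] two_tri[of "- 1 - r"] by (simp add: algebra_simps)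
    moreover have "(- 1 :: complex) powi (- 1 - r) = - ((- 1) powi r)"
      by (cases "even r") (simp_all add: power_int_minus_left)
    ultimately show ?thesis by (simp add: algebra_simps)
  qed
  then have "infsum ?f UNIV = - (\<Sum>\<^sub>\<infinity>r. ?f (- 1 - r))"
    by (simp add: infsum_uminus)
  also have "(\<Sum>\<^sub>\<infinity>r. ?f (- 1 - r)) = infsum ?f UNIV"
    by (rule infsum_int_reflect)
  finally have zero: "infsum ?f UNIV = 0" by simp
  have "pent r * (inv_qfact q (n - r) * inv_qfact q (n + r))
      = pent r * (inv_qfact q (n - r) * inv_qfact q (n + r + 1)) - q powi (n + 1) * ?f r" for r
  proof -
    have 1: "inv_qfact q (n + r) = (1 - q powi (n + 1) * q powi r) * inv_qfact q (n + r + 1)"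
      using inv_qfact_rec[OF q1 q0, of "n + r + 1"] q0 by (simp add: power_int_add)
    have 2: "q powi (3 * tri r + 3 * r) = q powi (3 * tri r + 2 * r) * q powi r"
      using q0 by (simp add: flip: power_int_add) (simp add: algebra_simps)
    show ?thesis unfolding 1 2 pent_def by (simp add: algebra_simps)
  qed
  then have "pent_sum n = pent_sum' n - q powi (n + 1) * infsum ?f UNIV"
    unfolding pent_sum_def pent_sum'_def
    by (simp add: infsum_minus summable_on_inv_qfact2 summable_on_pent summable_on_cmult_right
        infsum_cmult_right' pent_def)
  then show ?thesis by (simp add: zero)
qed

text \<open>Lowering n - r by one costs q^n times \<open>?g\<close>, and r -> -r turns
  \<open>?g\<close> into the summand of \<open>pent_sum n\<close>; hence the factor 1 - q^n.\<close>

lemma pent_sum'_rec: "pent_sum' (n - 1) = (1 - q powi n) * pent_sum n"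
proof -
  let ?g = "\<lambda>r. (- 1) powi r * q powi (3 * tri r + 1 * r) * (inv_qfact q (n - r) * inv_qfact q (n + r))"
  have "?g (0 - r) = pent r * (inv_qfact q (n - r) * inv_qfact q (n + r))" for r
  proof -
    have "3 * tri (0 - r) + 1 * (0 - r) = 3 * tri r + 2 * r" by (simp add: tri_uminus)
    then show ?thesis
      unfolding pent_def by (simp only:) (simp add: power_int_minus_one_minus)
  qed
  then have g: "infsum ?g UNIV = pent_sum n"
    unfolding pent_sum_def by (subst infsum_int_reflect[of ?g 0, symmetric]) (simp only:)
  have "pent r * (inv_qfact q (n - 1 - r) * inv_qfact q (n - 1 + r + 1))
     = pent r * (inv_qfact q (n - r) * inv_qfact q (n + r)) - q powi n * ?g r" for r
  proof -
    have 1: "inv_qfact q (n - 1 - r) = (1 - q powi n * q powi (- r)) * inv_qfact q (n - r)"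
      using inv_qfact_rec[OF q1 q0, of "n - r"] q0 by (simp add: algebra_simps flip: power_int_add)
    have 2: "q powi (3 * tri r + 1 * r) = q powi (3 * tri r + 2 * r) * q powi (- r)"
      using q0 by (simp add: algebra_simps flip: power_int_add)
    show ?thesis unfolding pent_def 1 2 by (simp add: algebra_simps)
  qed
  moreover have s1: "(\<lambda>r. pent r * (inv_qfact q (n - r) * inv_qfact q (n + r))) summable_on UNIV"
    unfolding pent_def by (intro summable_on_inv_qfact2 summable_on_pent)
  moreover have s2: "?g summable_on UNIV"
    by (intro summable_on_inv_qfact2 summable_on_pent)
  ultimately have "pent_sum' (n - 1) = pent_sum n - q powi n * infsum ?g UNIV"
    unfolding pent_sum_def pent_sum'_def
    by (simp only: infsum_minus[OF s1 summable_on_cmult_right[OF s2]] infsum_cmult_right')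
  then show ?thesis unfolding g by (simp add: algebra_simps)
qed

text \<open>The two preceding relations give (1 - q^n) \<open>pent_sum n\<close> =
  \<open>pent_sum (n - 1)\<close>, the recurrence of 1 / (q;q)_n. At n = 0 only r = 0 contributes;
  for n < 0 one of n - r and n + r is always negative.\<close>

lemma pent_sum_eq: "pent_sum n = inv_qfact q n"
proof (cases "n < 0")
  case True
  then have "inv_qfact q (n - r) * inv_qfact q (n + r) = 0" for r
    by (cases "r \<ge> 0") (auto simp: inv_qfact_def)
  then have "pent_sum n = 0" unfolding pent_sum_def by (simp only: mult_zero_right infsum_0_simp)
  then show ?thesis using True by (simp add: inv_qfact_def)
next
  case False
  have "pent_sum (int n) = inv_qfact q (int n)" for n
  proof (induction n)
    case 0
    have "pent_sum 0 = (\<Sum>\<^sub>\<infinity>r\<in>{0}. pent r * (inv_qfact q (0 - r) * inv_qfact q (0 + r)))"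
      unfolding pent_sum_def
      by (rule infsum_cong_neutral) (auto simp: inv_qfact_def)
    then show ?case by (simp add: pent_def inv_qfact_def qpoch_def tri_def)
  next
    case (Suc n)
    have "1 - q powi int (Suc n) \<noteq> 0"
      using power_Suc_neq_1[OF q1, of n] by (simp only: power_int_of_nat power_Suc) simp
    moreover have "(1 - q powi int (Suc n)) * pent_sum (int (Suc n))
        = (1 - q powi int (Suc n)) * inv_qfact q (int (Suc n))"
      using pent_sum'_rec[of "int (Suc n)"] pent_sum_eq_pent_sum'[of "int n"] Suc.IH
        inv_qfact_rec[OF q1 q0, of "int (Suc n)"] by simp
    ultimately show ?case by (simp only: mult_cancel_left) blast
  qed
  then show ?thesis using False by (metis int_nat_eq not_less)
qed

lemma pent_sum'_eq: "pent_sum' n = inv_qfact q n"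
  using pent_sum_eq pent_sum_eq_pent_sum' by simp

text \<open>The interchange of summations behind Bailey's lemma: d = 0 serves G and d = 1 serves
  H.\<close>

lemma infsum_inv_qfact_sums:
  assumes f: "f summable_on UNIV"
  shows "(\<Sum>\<^sub>\<infinity>n. f n * (\<Sum>\<^sub>\<infinity>r. pent r * (inv_qfact q (n - r) * inv_qfact q (n + r + d))))
       = (\<Sum>\<^sub>\<infinity>r. pent r * (\<Sum>\<^sub>\<infinity>n. f n * (inv_qfact q (n - r) * inv_qfact q (n + r + d))))"
proof -
  have "(\<lambda>(n, r). f n * pent r) summable_on (UNIV \<times> UNIV)"
    unfolding pent_def
    by (rule has_sum_imp_summable[OF has_sum_product_complex[OF has_sum_infsum[OF f]
            has_sum_infsum[OF summable_on_pent]]])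
  then have "(\<lambda>p. (case p of (n, r) \<Rightarrow> f n * pent r)
      * (inv_qfact q (fst p - snd p) * inv_qfact q (fst p + snd p + d))) summable_on (UNIV \<times> UNIV)"
    by (rule summable_on_inv_qfact2)
  then have "(\<lambda>(n, r). f n * (pent r * (inv_qfact q (n - r) * inv_qfact q (n + r + d))))
      summable_on (UNIV \<times> UNIV)"
    by (simp add: case_prod_unfold mult.assoc)
  then have "(\<Sum>\<^sub>\<infinity>n. \<Sum>\<^sub>\<infinity>r. f n * (pent r * (inv_qfact q (n - r) * inv_qfact q (n + r + d))))
       = (\<Sum>\<^sub>\<infinity>r. \<Sum>\<^sub>\<infinity>n. f n * (pent r * (inv_qfact q (n - r) * inv_qfact q (n + r + d))))"
    by (rule infsum_swap_banach)
  moreover have "pent r * (\<Sum>\<^sub>\<infinity>n. f n * (inv_qfact q (n - r) * inv_qfact q (n + r + d)))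
       = (\<Sum>\<^sub>\<infinity>n. f n * (pent r * (inv_qfact q (n - r) * inv_qfact q (n + r + d))))" for r
    by (subst infsum_cmult_right'[symmetric]) (simp only: mult.left_commute)
  ultimately show ?thesis
    by (simp only: infsum_cmult_right')
qed

lemma suminf_eq_infsum_int:
  fixes f :: "int \<Rightarrow> complex"
  assumes f: "f summable_on UNIV" and neg: "\<And>n. n < 0 \<Longrightarrow> f n = 0"
  shows "(\<Sum>n. f (int n)) = (\<Sum>\<^sub>\<infinity>n. f n)"
proof -
  have "(f has_sum infsum f UNIV) (range int)"
  proof (subst has_sum_cong_neutral[where T = UNIV and g = f])
    show "f x = 0" if "x \<in> UNIV - range int" for x
      using that neg[of x] by (metis DiffD2 not_less range_eqI zero_le_imp_eq_int)
  qed (use f in auto)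
  then have "((\<lambda>n. f (int n)) has_sum infsum f UNIV) UNIV"
    by (subst (asm) has_sum_reindex) (auto simp: o_def)
  then show ?thesis
    using has_sum_imp_sums sums_unique by metis
qed

text \<open>Each 1 / (q;q)_n is expanded as \<open>pent_sum n\<close>. After the interchange, n = m
  + r turns the inner sum into q^(r^2) times Cauchy's sum with k = 2r, whose value does not depend
  on r.\<close>

lemma rogers_ramanujan_G:
  "euler_E q * RR_G q = (\<Sum>\<^sub>\<infinity>r. (- 1) powi r * q powi (5 * tri r + 3 * r))"
proof -
  let ?f = "\<lambda>n. q powi (n\<^sup>2 + 0 * n)"
  have s: "(\<lambda>n. ?f n * inv_qfact q n) summable_on UNIV"
    using summable_on_inv_qfact2[OF summable_on_gauss_square[of 0], of "\<lambda>n. n" "\<lambda>_. 0"]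
    by (simp add: inv_qfact_def[of q 0] qpoch_def)
  have "RR_G q = (\<Sum>n. ?f (int n) * inv_qfact q (int n))"
    unfolding RR_G_def by (simp add: inv_qfact_def flip: power_int_of_nat)
  also have "\<dots> = (\<Sum>\<^sub>\<infinity>n. ?f n * inv_qfact q n)"
    by (rule suminf_eq_infsum_int[OF s]) (simp add: inv_qfact_def)
  also have "\<dots> = (\<Sum>\<^sub>\<infinity>n. ?f n * (\<Sum>\<^sub>\<infinity>r. pent r * (inv_qfact q (n - r) * inv_qfact q (n + r + 0))))"
    by (simp only: pent_sum_eq[unfolded pent_sum_def] add_0_right)
  also have "\<dots> = (\<Sum>\<^sub>\<infinity>r. pent r * (\<Sum>\<^sub>\<infinity>n. ?f n * (inv_qfact q (n - r) * inv_qfact q (n + r + 0))))"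
    by (rule infsum_inv_qfact_sums[OF summable_on_gauss_square])
  also have "(\<lambda>r. pent r * (\<Sum>\<^sub>\<infinity>n. ?f n * (inv_qfact q (n - r) * inv_qfact q (n + r + 0))))
      = (\<lambda>r. (- 1) powi r * q powi (5 * tri r + 3 * r) * (1 / euler_E q))"
  proof
    fix r
    have "(\<Sum>\<^sub>\<infinity>n. ?f n * (inv_qfact q (n - r) * inv_qfact q (n + r + 0)))
        = (\<Sum>\<^sub>\<infinity>m. ?f (m + r) * (inv_qfact q (m + r - r) * inv_qfact q (m + r + r + 0)))"
      by (rule infsum_int_shift[symmetric])
    also have "\<dots> = (\<Sum>\<^sub>\<infinity>m. q powi r\<^sup>2 * cauchy_term (2 * r) m)"
      using q0 by (simp add: cauchy_term_def power2_eq_square algebra_simps power_int_add)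
    also have "\<dots> = q powi r\<^sup>2 * (1 / euler_E q)"
      unfolding infsum_cmult_right' using cauchy_sum_eq[of "2 * r"] by (simp add: cauchy_sum_def)
    finally have 1: "(\<Sum>\<^sub>\<infinity>n. ?f n * (inv_qfact q (n - r) * inv_qfact q (n + r + 0)))
        = q powi r\<^sup>2 * (1 / euler_E q)" .
    have "3 * tri r + 2 * r + r\<^sup>2 = 5 * tri r + 3 * r"
      using two_tri[of r] by (simp add: power2_eq_square algebra_simps)
    then have 2: "q powi (3 * tri r + 2 * r) * q powi r\<^sup>2 = q powi (5 * tri r + 3 * r)"
      using q0 by (metis power_int_add)
    show "pent r * (\<Sum>\<^sub>\<infinity>n. ?f n * (inv_qfact q (n - r) * inv_qfact q (n + r + 0)))
        = (- 1) powi r * q powi (5 * tri r + 3 * r) * (1 / euler_E q)"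
      unfolding 1 2[symmetric] pent_def by (simp only: mult.assoc)
  qed
  also have "infsum \<dots> UNIV = (\<Sum>\<^sub>\<infinity>r. (- 1) powi r * q powi (5 * tri r + 3 * r)) * (1 / euler_E q)"
    by (rule infsum_cmult_left')
  finally show ?thesis using euler_E_nonzero[OF q1] by simp
qed

text \<open>The argument for G with \<open>pent_sum'\<close> in place of \<open>pent_sum\<close>;
  the offset d = 1 makes the parameter of Cauchy's sum 2r + 1.\<close>

lemma rogers_ramanujan_H:
  "euler_E q * RR_H q = (\<Sum>\<^sub>\<infinity>r. (- 1) powi r * q powi (5 * tri r + 4 * r))"
proof -
  let ?f = "\<lambda>n. q powi (n\<^sup>2 + 1 * n)"
  have s: "(\<lambda>n. ?f n * inv_qfact q n) summable_on UNIV"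
    using summable_on_inv_qfact2[OF summable_on_gauss_square[of 1], of "\<lambda>n. n" "\<lambda>_. 0"]
    by (simp add: inv_qfact_def[of q 0] qpoch_def)
  have "RR_H q = (\<Sum>n. ?f (int n) * inv_qfact q (int n))"
    unfolding RR_H_def
    by (simp add: inv_qfact_def power2_eq_square algebra_simps flip: power_int_of_nat)
  also have "\<dots> = (\<Sum>\<^sub>\<infinity>n. ?f n * inv_qfact q n)"
    by (rule suminf_eq_infsum_int[OF s]) (simp add: inv_qfact_def)
  also have "\<dots> = (\<Sum>\<^sub>\<infinity>n. ?f n * (\<Sum>\<^sub>\<infinity>r. pent r * (inv_qfact q (n - r) * inv_qfact q (n + r + 1))))"
    by (simp only: pent_sum'_eq[unfolded pent_sum'_def])
  also have "\<dots> = (\<Sum>\<^sub>\<infinity>r. pent r * (\<Sum>\<^sub>\<infinity>n. ?f n * (inv_qfact q (n - r) * inv_qfact q (n + r + 1))))"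
    by (rule infsum_inv_qfact_sums[OF summable_on_gauss_square])
  also have "(\<lambda>r. pent r * (\<Sum>\<^sub>\<infinity>n. ?f n * (inv_qfact q (n - r) * inv_qfact q (n + r + 1))))
      = (\<lambda>r. (- 1) powi r * q powi (5 * tri r + 4 * r) * (1 / euler_E q))"
  proof
    fix r
    have "(\<Sum>\<^sub>\<infinity>n. ?f n * (inv_qfact q (n - r) * inv_qfact q (n + r + 1)))
        = (\<Sum>\<^sub>\<infinity>m. ?f (m + r) * (inv_qfact q (m + r - r) * inv_qfact q (m + r + r + 1)))"
      by (rule infsum_int_shift[symmetric])
    also have "\<dots> = (\<Sum>\<^sub>\<infinity>m. q powi (r\<^sup>2 + r) * cauchy_term (2 * r + 1) m)"
      using q0 by (simp add: cauchy_term_def power2_eq_square algebra_simps power_int_add)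
    also have "\<dots> = q powi (r\<^sup>2 + r) * (1 / euler_E q)"
      unfolding infsum_cmult_right' using cauchy_sum_eq[of "2 * r + 1"] by (simp add: cauchy_sum_def)
    finally have 1: "(\<Sum>\<^sub>\<infinity>n. ?f n * (inv_qfact q (n - r) * inv_qfact q (n + r + 1)))
        = q powi (r\<^sup>2 + r) * (1 / euler_E q)" .
    have "3 * tri r + 2 * r + (r\<^sup>2 + r) = 5 * tri r + 4 * r"
      using two_tri[of r] by (simp add: power2_eq_square algebra_simps)
    then have 2: "q powi (3 * tri r + 2 * r) * q powi (r\<^sup>2 + r) = q powi (5 * tri r + 4 * r)"
      using q0 by (metis power_int_add)
    show "pent r * (\<Sum>\<^sub>\<infinity>n. ?f n * (inv_qfact q (n - r) * inv_qfact q (n + r + 1)))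
        = (- 1) powi r * q powi (5 * tri r + 4 * r) * (1 / euler_E q)"
      unfolding 1 2[symmetric] pent_def by (simp only: mult.assoc)
  qed
  also have "infsum \<dots> UNIV = (\<Sum>\<^sub>\<infinity>r. (- 1) powi r * q powi (5 * tri r + 4 * r)) * (1 / euler_E q)"
    by (rule infsum_cmult_left')
  finally show ?thesis using euler_E_nonzero[OF q1] by simp
qed

end

section \<open>Theta series with periodic weights\<close>

definition chi3 :: "int \<Rightarrow> int" where
  "chi3 x = (if x mod 3 = 1 then 1 else if x mod 3 = 2 then - 1 else 0)"

definition chi4 :: "int \<Rightarrow> int" where
  "chi4 x = (if x mod 4 = 1 then 1 else if x mod 4 = 3 then - 1 else 0)"

text \<open>The quadratic character modulo 12, factored so that conditions modulo 4 and modulo 3 can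
  be treated separately.\<close>

definition chi12 :: "int \<Rightarrow> int" where
  "chi12 x = chi4 x * chi3 x"

text \<open>The two odd functions modulo 5 that belong to \<open>G\<close> and \<open>H\<close>: up to the factor \<^const>\<open>chi4\<close>,
  they are the coefficients of the theta series of \<open>E G\<close> and \<open>E H\<close>.\<close>
definition odd5G :: "int \<Rightarrow> int" where
  "odd5G x = (if x mod 5 = 1 then 1 else if x mod 5 = 4 then - 1 else 0)"

definition odd5H :: "int \<Rightarrow> int" where
  "odd5H x = (if x mod 5 = 2 then 1 else if x mod 5 = 3 then - 1 else 0)"

text \<open>Used for the square classes c = 0, 1, 4 modulo 5, which cut the theta series of E into
  the components of its 5-dissection.\<close>

definition sq5 :: "int \<Rightarrow> int \<Rightarrow> int" where
  "sq5 c x = of_bool (x\<^sup>2 mod 5 = c)"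

section \<open>Congruence indicators as products of characters\<close>

lemma dvd_residue:
  fixes m n :: int
  assumes "coprime m n" "m dvd a - c" "n dvd a - d"
  shows "m * n dvd x + a * y \<longleftrightarrow> m dvd x + c * y \<and> n dvd x + d * y"
proof -
  have "m dvd x + a * y \<longleftrightarrow> m dvd x + c * y" "n dvd x + a * y \<longleftrightarrow> n dvd x + d * y"
    using dvd_add_left_iff[OF dvd_mult2[OF assms(2), of y], of "x + c * y"]
      dvd_add_left_iff[OF dvd_mult2[OF assms(3), of y], of "x + d * y"]
    by (simp_all add: algebra_simps)
  moreover have "m * n dvd z \<longleftrightarrow> m dvd z \<and> n dvd z" for z
    using assms(1) by (meson divides_mult dvd_mult_left dvd_mult_right)
  ultimately show ?thesis by simp
qed

lemma coprime_small: "coprime (4::int) 3" "coprime (4::int) 5" "coprime (12::int) 5"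
  by code_simp+

lemma int_mod_cases:
  "(x::int) mod 3 = 0 \<or> x mod 3 = 1 \<or> x mod 3 = 2"
  "x mod 4 = 0 \<or> x mod 4 = 1 \<or> x mod 4 = 2 \<or> x mod 4 = 3"
  "x mod 5 = 0 \<or> x mod 5 = 1 \<or> x mod 5 = 2 \<or> x mod 5 = 3 \<or> x mod 5 = 4"
  by presburger+

lemma dvd_mod_combination:
  fixes m :: int
  shows "m dvd x + a * y \<longleftrightarrow> m dvd x mod m + a * (y mod m)"
    and "m dvd x - a * y \<longleftrightarrow> m dvd x mod m - a * (y mod m)"
  unfolding dvd_eq_mod_eq_0 by (metis mod_add_eq mod_mod_trivial mod_mult_right_eq)
    (metis mod_diff_eq mod_mod_trivial mod_mult_right_eq)

lemma chi3_prod: "of_bool (3 dvd x - y) - of_bool (3 dvd x + y) = chi3 x * chi3 y"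
  unfolding chi3_def
  using int_mod_cases(1)[of x] int_mod_cases(1)[of y] dvd_mod_combination[of 3 x 1 y]
  by (elim disjE) (simp_all only: mult_1, simp_all)

lemma chi4_prod: "of_bool (4 dvd x - y) - of_bool (4 dvd x + y) = chi4 x * chi4 y"
  unfolding chi4_def
  using int_mod_cases(2)[of x] int_mod_cases(2)[of y] dvd_mod_combination[of 4 x 1 y]
  by (elim disjE) (simp_all only: mult_1, simp_all)

text \<open>The sign choices in x = +-y modulo 4 and x = +-y modulo 3 combine into the four classes
  x = +-y, +-5y modulo 12. Equal signs carry weight 1, unequal signs weight -1.\<close>

lemma chi12_prod:
  "chi12 x * chi12 y = of_bool (12 dvd x - y) + of_bool (12 dvd x + y)
     - (of_bool (12 dvd x - 5 * y) + of_bool (12 dvd x + 5 * y))"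
proof -
  have 1: "(12 dvd x - y) = (4 dvd x - y \<and> 3 dvd x - y)"
    using dvd_residue[of 4 3 "- 1" "- 1" "- 1" x y] by (simp add: coprime_small)
  have 2: "(12 dvd x + y) = (4 dvd x + y \<and> 3 dvd x + y)"
    using dvd_residue[of 4 3 1 1 1 x y] by (simp add: coprime_small)
  have 3: "(12 dvd x - 5 * y) = (4 dvd x - y \<and> 3 dvd x + y)"
    using dvd_residue[of 4 3 "- 5" "- 1" 1 x y] by (simp add: coprime_small)
  have 4: "(12 dvd x + 5 * y) = (4 dvd x + y \<and> 3 dvd x - y)"
    using dvd_residue[of 4 3 5 1 "- 1" x y] by (simp add: coprime_small)
  have "chi12 x * chi12 y = (chi4 x * chi4 y) * (chi3 x * chi3 y)"
    by (simp add: chi12_def)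
  then show ?thesis
    unfolding 1 2 3 4 of_bool_conj chi3_prod[symmetric] chi4_prod[symmetric]
    by (simp add: algebra_simps)
qed

lemma odd5_prod:
  "of_bool (5 dvd x - 2 * y) - of_bool (5 dvd x + 2 * y) = odd5H x * odd5G y - odd5G x * odd5H y"
  unfolding odd5G_def odd5H_def
    dvd_mod_combination[of 5 x 2 y]
  using int_mod_cases(3)[of x] int_mod_cases(3)[of y] by (elim disjE) simp_all

lemma sq5_alt:
  "sq5 0 x = of_bool (x mod 5 = 0)"
  "sq5 1 x = of_bool (x mod 5 = 1 \<or> x mod 5 = 4)"
  "sq5 4 x = of_bool (x mod 5 = 2 \<or> x mod 5 = 3)"
proof -
  have "x\<^sup>2 mod 5 = (x mod 5)\<^sup>2 mod 5" by (simp add: power_mod)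
  moreover note int_mod_cases(3)[of x]
  ultimately show "sq5 0 x = of_bool (x mod 5 = 0)"
    "sq5 1 x = of_bool (x mod 5 = 1 \<or> x mod 5 = 4)"
    "sq5 4 x = of_bool (x mod 5 = 2 \<or> x mod 5 = 3)"
    unfolding sq5_def by auto
qed

text \<open>The factor 2 occurs because both congruences hold when 5 divides x and y.\<close>

lemma sq5_prod:
  "of_bool (5 dvd x - 2 * y) + of_bool (5 dvd x + 2 * y)
     = sq5 1 x * sq5 4 y + sq5 4 x * sq5 1 y + 2 * (sq5 0 x * sq5 0 y)"
  unfolding sq5_alt
    dvd_mod_combination[of 5 x 2 y]
  using int_mod_cases(3)[of x] int_mod_cases(3)[of y] by (elim disjE) simp_all

text \<open>The residues 3 and 7 are the middle coefficients of (10,3,2) and (10,7,3), which are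
  equivalent to (2,1,9) and (3,1,6).\<close>

lemma weights_mod_20:
  "(of_bool (20 dvd x - 3 * y) + of_bool (20 dvd x + 3 * y))
      - (of_bool (20 dvd x - 7 * y) + of_bool (20 dvd x + 7 * y))
     = (chi4 x * odd5H x) * (chi4 y * odd5G y) - (chi4 x * odd5G x) * (chi4 y * odd5H y)"
proof -
  have 1: "(20 dvd x - 3 * y) = (4 dvd x + y \<and> 5 dvd x + 2 * y)"
    using dvd_residue[of 4 5 "- 3" 1 2 x y] by (simp add: coprime_small)
  have 2: "(20 dvd x + 3 * y) = (4 dvd x - y \<and> 5 dvd x - 2 * y)"
    using dvd_residue[of 4 5 3 "- 1" "- 2" x y] by (simp add: coprime_small)
  have 3: "(20 dvd x - 7 * y) = (4 dvd x + y \<and> 5 dvd x - 2 * y)"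
    using dvd_residue[of 4 5 "- 7" 1 "- 2" x y] by (simp add: coprime_small)
  have 4: "(20 dvd x + 7 * y) = (4 dvd x - y \<and> 5 dvd x + 2 * y)"
    using dvd_residue[of 4 5 7 "- 1" 2 x y] by (simp add: coprime_small)
  have "(chi4 x * odd5H x) * (chi4 y * odd5G y) - (chi4 x * odd5G x) * (chi4 y * odd5H y)
      = (chi4 x * chi4 y) * (odd5H x * odd5G y - odd5G x * odd5H y)"
    by (simp add: algebra_simps)
  then show ?thesis
    unfolding 1 2 3 4 of_bool_conj odd5_prod[symmetric] chi4_prod[symmetric]
    by (simp add: algebra_simps)
qed

text \<open>The middle coefficients 17, 23, 13, 7 of the forms with leading coefficient 30 realize
  all combinations of x = +-y, +-5y modulo 12 with x = +-2y modulo 5. Their signs are opposite to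
  those in \<open>chi12_prod\<close>.\<close>

lemma weights_mod_60:
  "of_bool (60 dvd x - 17 * y) + of_bool (60 dvd x + 17 * y)
      - (of_bool (60 dvd x - 23 * y) + of_bool (60 dvd x + 23 * y))
      - (of_bool (60 dvd x - 13 * y) + of_bool (60 dvd x + 13 * y))
      + (of_bool (60 dvd x - 7 * y) + of_bool (60 dvd x + 7 * y))
     = - ((sq5 1 x * chi12 x) * (sq5 4 y * chi12 y) + (sq5 4 x * chi12 x) * (sq5 1 y * chi12 y)
          + 2 * ((sq5 0 x * chi12 x) * (sq5 0 y * chi12 y)))"
proof -
  have 1: "(60 dvd x - 17 * y) = (12 dvd x - 5 * y \<and> 5 dvd x - 2 * y)"
    using dvd_residue[of 12 5 "- 17" "- 5" "- 2" x y] by (simp add: coprime_small)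
  have 2: "(60 dvd x + 17 * y) = (12 dvd x + 5 * y \<and> 5 dvd x + 2 * y)"
    using dvd_residue[of 12 5 17 5 2 x y] by (simp add: coprime_small)
  have 3: "(60 dvd x - 23 * y) = (12 dvd x + y \<and> 5 dvd x + 2 * y)"
    using dvd_residue[of 12 5 "- 23" 1 2 x y] by (simp add: coprime_small)
  have 4: "(60 dvd x + 23 * y) = (12 dvd x - y \<and> 5 dvd x - 2 * y)"
    using dvd_residue[of 12 5 23 "- 1" "- 2" x y] by (simp add: coprime_small)
  have 5: "(60 dvd x - 13 * y) = (12 dvd x - y \<and> 5 dvd x + 2 * y)"
    using dvd_residue[of 12 5 "- 13" "- 1" 2 x y] by (simp add: coprime_small)
  have 6: "(60 dvd x + 13 * y) = (12 dvd x + y \<and> 5 dvd x - 2 * y)"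
    using dvd_residue[of 12 5 13 1 "- 2" x y] by (simp add: coprime_small)
  have 7: "(60 dvd x - 7 * y) = (12 dvd x + 5 * y \<and> 5 dvd x - 2 * y)"
    using dvd_residue[of 12 5 "- 7" 5 "- 2" x y] by (simp add: coprime_small)
  have 8: "(60 dvd x + 7 * y) = (12 dvd x - 5 * y \<and> 5 dvd x + 2 * y)"
    using dvd_residue[of 12 5 7 "- 5" 2 x y] by (simp add: coprime_small)
  have "- ((sq5 1 x * chi12 x) * (sq5 4 y * chi12 y) + (sq5 4 x * chi12 x) * (sq5 1 y * chi12 y)
          + 2 * ((sq5 0 x * chi12 x) * (sq5 0 y * chi12 y)))
      = - (chi12 x * chi12 y) * (of_bool (5 dvd x - 2 * y) + of_bool (5 dvd x + 2 * y))"
    unfolding sq5_prod by (simp add: algebra_simps)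
  then show ?thesis
    unfolding 1 2 3 4 5 6 7 8 of_bool_conj chi12_prod by (simp add: algebra_simps)
qed

text \<open>The support consists of the classes of b and -b modulo a, which have equal sums by
  evenness. They are disjoint because a does not divide 2b.\<close>

lemma has_sum_even_progression:
  fixes f :: "int \<Rightarrow> complex"
  assumes s: "((\<lambda>n. f (a * n + b)) has_sum s) UNIV" and even: "\<And>x. f (- x) = f x"
    and a: "a \<noteq> 0" "\<not> a dvd 2 * b" and supp: "\<And>x. \<not> a dvd x - b \<Longrightarrow> \<not> a dvd x + b \<Longrightarrow> f x = 0"
  shows "(f has_sum 2 * s) UNIV"
proof -
  let ?A = "{x. a dvd x - b}" and ?B = "{x. a dvd x + b}"
  have "(f has_sum s) ?A"
    using s by (subst (asm) has_sum_reindex_bij_witness[of _ "\<lambda>x. (x - b) div a" "\<lambda>n. a * n + b" ?A f])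
      (use a in auto)
  moreover have "(f has_sum s) ?A \<longleftrightarrow> (f has_sum s) ?B"
  proof (rule has_sum_reindex_bij_witness[of _ uminus uminus])
    show "- x \<in> ?B" if "x \<in> ?A" for x
      using that dvd_diff_commute[of a x b] by simp
    show "- x \<in> ?A" if "x \<in> ?B" for x
      using that dvd_minus_iff[of a "x + b"] by (simp only: minus_add_distrib mem_Collect_eq) simp
  qed (simp_all add: even)
  moreover have "?A \<inter> ?B = {}"
  proof -
    have False if "a dvd x - b" "a dvd x + b" for x
      using dvd_diff[OF that(2,1)] a by (simp add: algebra_simps)
    then show ?thesis by blast
  qed
  ultimately have "(f has_sum s + s) (?A \<union> ?B)"
    by (intro has_sum_Un_disjoint) auto
  moreover have "(f has_sum s + s) (?A \<union> ?B) \<longleftrightarrow> (f has_sum s + s) UNIV"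
    by (rule has_sum_cong_neutral) (use supp in auto)
  ultimately show ?thesis by simp
qed

lemma chi_uminus [simp]:
  "chi3 (- x) = - chi3 x" "chi4 (- x) = - chi4 x" "chi12 (- x) = chi12 x"
  "odd5G (- x) = - odd5G x" "odd5H (- x) = - odd5H x" "sq5 c (- x) = sq5 c x"
proof -
  show 1: "chi3 (- x) = - chi3 x" unfolding chi3_def by presburger
  show 2: "chi4 (- x) = - chi4 x" unfolding chi4_def by presburger
  show "chi12 (- x) = chi12 x" unfolding chi12_def by (simp add: 1 2)
  show "odd5G (- x) = - odd5G x" unfolding odd5G_def by presburger
  show "odd5H (- x) = - odd5H x" unfolding odd5H_def by presburger
  show "sq5 c (- x) = sq5 c x" by (simp add: sq5_def)
qed

lemma chi4_periodic: "chi4 (x + 4 * k) = chi4 x"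
  unfolding chi4_def by simp

lemma chi3_periodic: "chi3 (x + 3 * k) = chi3 x"
  unfolding chi3_def by simp

lemma chi4_even: "even x \<Longrightarrow> chi4 x = 0"
  unfolding chi4_def by presburger

lemma chi4_square: "odd x \<Longrightarrow> chi4 x * chi4 x = 1"
proof -
  assume "odd x"
  then have "x mod 4 = 1 \<or> x mod 4 = 3" by presburger
  then show ?thesis by (auto simp: chi4_def)
qed

lemma minus_one_powi: "(- 1 :: complex) powi n = (if even n then 1 else - 1)"
  by (simp add: power_int_minus_left)

lemma power_powi: "(r ^ k) powi n = r powi (int k * n)" for r :: complex
  by (simp add: power_int_mult)

lemma norm_power_less_1: "norm (r ^ k) < 1" if "norm r < 1" "k > 0" for r :: complex
  using that by (simp add: norm_power power_less_one_iff)

section \<open>Theta series in one variable and norm forms x^2 + D y^2\<close>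

context
  fixes r :: complex
  assumes r1: "norm r < 1" and r0: "r \<noteq> 0"
begin

text \<open>Euler's pentagonal number theorem: the triple product with base q^3 at x = q collects
  the classes 1, 2, 3 modulo 3 of the factors of E(q). The exponents become squares through (6n -
  1)^2 = 1 + 24 (n + 3 \<open>tri n\<close>).\<close>

lemma has_sum_chi12: "((\<lambda>x. of_int (chi12 x) * r powi x\<^sup>2) has_sum 2 * (r * euler_E (r ^ 24))) UNIV"
proof -
  define q where "q = r ^ 24"
  have q: "norm q < 1" "q \<noteq> 0" using r0 r1 by (auto simp: q_def norm_power_less_1)
  have "((\<lambda>n. (- q) powi n * (q ^ 3) powi tri n) has_sum
      qpoch_inf q (q ^ 3) * qpoch_inf (q ^ 3 / q) (q ^ 3) * euler_E (q ^ 3)) UNIV"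
    using q by (intro jacobi_triple_product) (auto simp: norm_power_less_1)
  moreover have "qpoch_inf q (q ^ 3) * qpoch_inf (q ^ 3 / q) (q ^ 3) * euler_E (q ^ 3) = euler_E q"
  proof -
    have "q ^ 3 / q = q\<^sup>2" using q by (simp add: eval_nat_numeral)
    then show ?thesis
      unfolding euler_E_multisection[OF q(1), of 3, simplified]
      by (simp add: euler_E_def eval_nat_numeral)
  qed
  moreover have "r * ((- q) powi n * (q ^ 3) powi tri n)
      = of_int (chi12 (6 * n + - 1)) * r powi (6 * n + - 1)\<^sup>2" for n
  proof -
    have "chi12 (6 * n + - 1) = (if even n then 1 else - 1)"
    proof -
      have "(6 * n + - 1) mod 3 = 2" "(6 * n + - 1) mod 4 = (if even n then 3 else 1)" by presburger+
      then show ?thesis by (simp add: chi12_def chi3_def chi4_def)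
    qed
    moreover have "(6 * n + - 1)\<^sup>2 = 1 + (24 * n + 72 * tri n)"
      using two_tri[of n] by (simp add: power2_eq_square algebra_simps)
    moreover have "(- q) powi n = (- 1) powi n * q powi n"
      by (metis mult_minus1 power_int_mult_distrib)
    ultimately show ?thesis
      using r0 by (simp add: q_def power_powi minus_one_powi power_int_add flip: power_mult)
  qed
  ultimately have "((\<lambda>n. of_int (chi12 (6 * n + - 1)) * r powi (6 * n + - 1)\<^sup>2) has_sum r * euler_E q) UNIV"
    using has_sum_cmult_right[of "\<lambda>n. (- q) powi n * (q ^ 3) powi tri n" UNIV "euler_E q" r] by simp
  then show ?thesis
    unfolding q_def
  proof (rule has_sum_even_progression)
    show "of_int (chi12 x) * r powi x\<^sup>2 = 0" if "\<not> 6 dvd x - (- 1)" "\<not> 6 dvd x + - 1" for x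
    proof -
      have "even x \<or> x mod 3 = 0" using that by presburger
      then show ?thesis by (auto simp: chi12_def chi3_def chi4_even)
    qed
  qed auto
qed

text \<open>The square is completed by 1 + 40 (5 \<open>tri n\<close> + 3n) = (10n + 1)^2, and
  (-1)^n is a function of 10n + 1 modulo 20. For H the square is (10n + 3)^2, whence the factor r^9
  there.\<close>

lemma has_sum_chi4_odd5G:
  "((\<lambda>x. of_int (chi4 x * odd5G x) * r powi x\<^sup>2) has_sum
      2 * (r * (euler_E (r ^ 40) * RR_G (r ^ 40)))) UNIV"
proof -
  define q where "q = r ^ 40"
  have q: "norm q < 1" "q \<noteq> 0" using r0 r1 by (auto simp: q_def norm_power_less_1)
  have "((\<lambda>n. (- 1) powi n * q powi (5 * tri n + 3 * n)) has_sum euler_E q * RR_G q) UNIV"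
    unfolding rogers_ramanujan_G[OF q]
    by (intro has_sum_infsum summable_on_bounded_mult[where K = 1] summable_on_int_quadratic q)
      (auto simp: minus_one_powi)
  moreover have "r * ((- 1) powi n * q powi (5 * tri n + 3 * n))
      = of_int (chi4 (10 * n + 1) * odd5G (10 * n + 1)) * r powi (10 * n + 1)\<^sup>2" for n
  proof -
    have "chi4 (10 * n + 1) * odd5G (10 * n + 1) = (if even n then 1 else - 1)"
    proof -
      have "(10 * n + 1) mod 5 = 1" "(10 * n + 1) mod 4 = (if even n then 1 else 3)" by presburger+
      then show ?thesis by (simp add: odd5G_def chi4_def)
    qed
    moreover have "(10 * n + 1)\<^sup>2 = 1 + 40 * (5 * tri n + 3 * n)"
      using two_tri[of n] by (simp add: power2_eq_square algebra_simps)
    ultimately show ?thesis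
      using r0 by (simp add: q_def power_powi minus_one_powi power_int_add)
  qed
  ultimately have "((\<lambda>n. of_int (chi4 (10 * n + 1) * odd5G (10 * n + 1)) * r powi (10 * n + 1)\<^sup>2)
      has_sum r * (euler_E q * RR_G q)) UNIV"
    using has_sum_cmult_right[of "\<lambda>n. (- 1) powi n * q powi (5 * tri n + 3 * n)" UNIV _ r] by simp
  then show ?thesis
    unfolding q_def
  proof (rule has_sum_even_progression)
    show "of_int (chi4 x * odd5G x) * r powi x\<^sup>2 = 0" if "\<not> 10 dvd x - 1" "\<not> 10 dvd x + 1" for x
    proof -
      have "even x \<or> x mod 5 \<noteq> 1 \<and> x mod 5 \<noteq> 4" using that by presburger
      then show ?thesis by (auto simp: odd5G_def chi4_even)
    qed
  qed auto
qed

lemma has_sum_chi4_odd5H: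
  "((\<lambda>x. of_int (chi4 x * odd5H x) * r powi x\<^sup>2) has_sum
      2 * (r ^ 9 * (euler_E (r ^ 40) * RR_H (r ^ 40)))) UNIV"
proof -
  define q where "q = r ^ 40"
  have q: "norm q < 1" "q \<noteq> 0" using r0 r1 by (auto simp: q_def norm_power_less_1)
  have "((\<lambda>n. (- 1) powi n * q powi (5 * tri n + 4 * n)) has_sum euler_E q * RR_H q) UNIV"
    unfolding rogers_ramanujan_H[OF q]
    by (intro has_sum_infsum summable_on_bounded_mult[where K = 1] summable_on_int_quadratic q)
      (auto simp: minus_one_powi)
  moreover have "r ^ 9 * ((- 1) powi n * q powi (5 * tri n + 4 * n))
      = of_int (chi4 (10 * n + 3) * odd5H (10 * n + 3)) * r powi (10 * n + 3)\<^sup>2" for n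
  proof -
    have "chi4 (10 * n + 3) * odd5H (10 * n + 3) = (if even n then 1 else - 1)"
    proof -
      have "(10 * n + 3) mod 5 = 3" "(10 * n + 3) mod 4 = (if even n then 3 else 1)" by presburger+
      then show ?thesis by (simp add: odd5H_def chi4_def)
    qed
    moreover have "(10 * n + 3)\<^sup>2 = 9 + 40 * (5 * tri n + 4 * n)"
      using two_tri[of n] by (simp add: power2_eq_square algebra_simps)
    ultimately show ?thesis
      using r0 by (simp add: q_def power_powi minus_one_powi power_int_add)
  qed
  ultimately have "((\<lambda>n. of_int (chi4 (10 * n + 3) * odd5H (10 * n + 3)) * r powi (10 * n + 3)\<^sup>2)
      has_sum r ^ 9 * (euler_E q * RR_H q)) UNIV"
    using has_sum_cmult_right[of "\<lambda>n. (- 1) powi n * q powi (5 * tri n + 4 * n)" UNIV _ "r ^ 9"] by simp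
  then show ?thesis
    unfolding q_def
  proof (rule has_sum_even_progression)
    show "of_int (chi4 x * odd5H x) * r powi x\<^sup>2 = 0" if "\<not> 10 dvd x - 3" "\<not> 10 dvd x + 3" for x
    proof -
      have "even x \<or> x mod 5 \<noteq> 2 \<and> x mod 5 \<noteq> 3" using that by presburger
      then show ?thesis by (auto simp: odd5H_def chi4_even)
    qed
  qed auto
qed

lemma summable_on_binary:
  assumes "D > 0"
  shows "(\<lambda>(x, y). r powi (x\<^sup>2 + D * y\<^sup>2)) summable_on UNIV"
proof -
  have "norm (r ^ nat D) < 1" "r ^ nat D \<noteq> 0" using assms r0 r1 by (auto simp: norm_power_less_1)
  then have "(\<lambda>(x, y). r powi (x\<^sup>2 + 0 * x) * (r ^ nat D) powi (y\<^sup>2 + 0 * y)) summable_on UNIV \<times> UNIV"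
    using r0 r1 by (intro has_sum_imp_summable[OF has_sum_product_complex[OF has_sum_infsum has_sum_infsum]]
        summable_on_gauss_square)
  then show ?thesis
    using assms r0 by (simp add: power_powi power_int_add)
qed

text \<open>Since 4a (a n^2 + b n m + c m^2) = (2an + bm)^2 + D m^2, the map (n, m) -> (2an + bm, m)
  parametrizes the pairs with x = b y modulo 2a.\<close>

lemma has_sum_theta_residue:
  assumes D: "D = 4 * a * c - b\<^sup>2" "D > 0" and a: "a > 0"
  shows "((\<lambda>(x, y). of_int (of_bool (2 * a dvd x - b * y)) * r powi (x\<^sup>2 + D * y\<^sup>2)) has_sum
            theta_form a b c (r powi (4 * a))) UNIV"
proof -
  let ?f = "\<lambda>(x, y). of_int (of_bool (2 * a dvd x - b * y)) * r powi (x\<^sup>2 + D * y\<^sup>2)"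
  let ?A = "{(x, y). 2 * a dvd x - b * y}"
  have "(\<lambda>p. (case p of (x, y) \<Rightarrow> of_int (of_bool (2 * a dvd x - b * y)))
      * (case p of (x, y) \<Rightarrow> r powi (x\<^sup>2 + D * y\<^sup>2))) summable_on UNIV"
    by (rule summable_on_bounded_mult[OF summable_on_binary[OF D(2)], where K = 1]) auto
  then have "(?f has_sum infsum ?f UNIV) UNIV"
    by (simp add: case_prod_unfold)
  moreover have "infsum ?f UNIV = infsum ?f ?A"
    by (rule infsum_cong_neutral) auto
  moreover have "theta_form a b c (r powi (4 * a)) = infsum ?f ?A"
    unfolding theta_form_def
  proof (rule infsum_reindex_bij_witness[of _ "\<lambda>(x, y). ((x - b * y) div (2 * a), y)"
        "\<lambda>(n, m). (2 * a * n + b * m, m)"])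
    fix p :: "int \<times> int"
    obtain n m where p: "p = (n, m)" by (cases p)
    have "(2 * a * n + b * m)\<^sup>2 + D * m\<^sup>2 = 4 * a * (a * n\<^sup>2 + b * n * m + c * m\<^sup>2)"
      by (simp add: D power2_eq_square algebra_simps)
    then show "?f (case p of (n, m) \<Rightarrow> (2 * a * n + b * m, m))
        = (case p of (n, m) \<Rightarrow> (r powi (4 * a)) powi (a * n\<^sup>2 + b * n * m + c * m\<^sup>2))"
      using r0 by (simp add: p power_int_mult)
  qed (use a in \<open>auto simp: mult.assoc\<close>)
  ultimately show ?thesis by simp
qed

text \<open>Adding the image under y -> -y makes the weight even in y, the shape in which the
  products of characters above expand.\<close>

lemma has_sum_theta_residues:
  assumes D: "D = 4 * a * c - b\<^sup>2" "D > 0" and a: "a > 0"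
  shows "((\<lambda>(x, y). of_int (of_bool (2 * a dvd x - b * y) + of_bool (2 * a dvd x + b * y))
              * r powi (x\<^sup>2 + D * y\<^sup>2)) has_sum 2 * theta_form a b c (r powi (4 * a))) UNIV"
proof -
  let ?w = "\<lambda>b (x, y). of_int (of_bool (2 * a dvd x - b * y)) * r powi (x\<^sup>2 + D * y\<^sup>2)"
  note * = has_sum_theta_residue[OF assms]
  then have "(?w (- b) has_sum theta_form a b c (r powi (4 * a))) UNIV"
  proof (subst has_sum_reindex_bij_witness[of UNIV "\<lambda>(x, y). (x, - y)" "\<lambda>(x, y). (x, - y)" UNIV "?w b"])
  qed auto
  from has_sum_add[OF * this] show ?thesis
    by (simp add: case_prod_unfold distrib_right)
qed

lemma has_sum_product_residues:
  assumes "((\<lambda>x. of_int (v x) * r powi x\<^sup>2) has_sum s) UNIV"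
    and "((\<lambda>y. of_int (w y) * (r ^ D) powi y\<^sup>2) has_sum t) UNIV"
  shows "((\<lambda>(x, y). of_int (v x * w y) * r powi (x\<^sup>2 + int D * y\<^sup>2)) has_sum s * t) UNIV"
  using has_sum_product_complex[OF assms] r0 by (simp add: power_powi power_int_add mult_ac)

text \<open>On the support of the weight one has \<open>x = \<plusminus>y\<close> modulo 4, and \<open>y \<mapsto> -y\<close> exchanges the two cases.
  For \<open>x = y + 4k\<close> the norm form is \<open>x\<^sup>2 + 3y\<^sup>2 = 4 (y + k)\<^sup>2 + 12 k\<^sup>2\<close>, and the reflection
  \<open>y + k \<mapsto> - (y + k)\<close> (multiplication by a sixth root of unity, up to conjugation) changes
  the sign of the weight.\<close>
lemma hexagonal_cancellation:
  assumes F: "\<And>x y. F x (- y) = - F x y" "\<And>k y. F (2 * k - y) (- y - 2 * k) = F (y + 4 * k) y"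
    and s: "((\<lambda>(x, y). of_int (chi12 x * chi4 y * F x y) * r powi (x\<^sup>2 + 3 * y\<^sup>2)) has_sum s) UNIV"
  shows "s = 0"
proof -
  let ?f = "\<lambda>(x, y). of_int (chi12 x * chi4 y * F x y) * r powi (x\<^sup>2 + 3 * y\<^sup>2) :: complex"
  let ?A = "{(x::int, y::int). odd y \<and> 4 dvd x - y}" and ?B = "{(x::int, y::int). odd y \<and> 4 dvd x + y}"
  have summ: "?f summable_on A" for A
    using s has_sum_imp_summable summable_on_subset_banach by blast
  have "infsum ?f ?A = infsum (\<lambda>p. - ?f p) ?A"
  proof (rule infsum_reindex_bij_witness[of _ "\<lambda>(x, y). (2 * ((x - y) div 4) - y, - y - 2 * ((x - y) div 4))"
        "\<lambda>(x, y). (2 * ((x - y) div 4) - y, - y - 2 * ((x - y) div 4))"])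
    fix p :: "int \<times> int" assume "p \<in> ?A"
    then obtain x y where "p = (x, y)" "odd y" "4 dvd x - y" by auto
    then obtain k where p: "p = (y + 4 * k, y)" and "odd y"
      by (metis add_diff_cancel_left' diff_add_cancel add.commute dvdE)
    have j: "(case p of (x, y) \<Rightarrow> (2 * ((x - y) div 4) - y, - y - 2 * ((x - y) div 4)))
        = (2 * k - y, - y - 2 * k)"
      by (simp add: p)
    have "(2 * k - y)\<^sup>2 + 3 * (- y - 2 * k)\<^sup>2 = (y + 4 * k)\<^sup>2 + 3 * y\<^sup>2"
      by (simp add: power2_eq_square algebra_simps)
    moreover have "chi12 (y + 4 * k) * chi4 y = chi3 (y + 4 * k)"
      using chi4_square[OF \<open>odd y\<close>] by (simp add: chi12_def chi4_periodic)
    moreover have "chi12 (2 * k - y) * chi4 (- y - 2 * k) = chi3 (2 * k - y)"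
    proof -
      have "- y - 2 * k = (2 * k - y) + 4 * (- k)" by simp
      then have "chi4 (- y - 2 * k) = chi4 (2 * k - y)" by (simp only: chi4_periodic)
      then show ?thesis
        using chi4_square[of "2 * k - y"] \<open>odd y\<close> by (simp add: chi12_def)
    qed
    moreover have "chi3 (2 * k - y) = - chi3 (y + 4 * k)"
    proof -
      have "2 * k - y = - (y + 4 * k) + 3 * (2 * k)" by simp
      then show ?thesis by (simp only: chi3_periodic chi_uminus)
    qed
    ultimately show "- ?f (case p of (x, y) \<Rightarrow> (2 * ((x - y) div 4) - y, - y - 2 * ((x - y) div 4))) = ?f p"
      unfolding j unfolding p by (simp add: F del: of_int_mult)
  qed (auto elim!: dvdE simp: algebra_simps, presburger+)
  then have A: "infsum ?f ?A = 0"
    by (simp add: infsum_uminus)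
  have "infsum ?f ?B = infsum ?f ?A"
    by (rule infsum_reindex_bij_witness[of _ "\<lambda>(x, y). (x, - y)" "\<lambda>(x, y). (x, - y)"]) (auto simp: F)
  moreover have "?A \<inter> ?B = {}"
  proof -
    have False if "odd y" "4 dvd x - y" "4 dvd x + y" for x y :: int
      using dvd_diff[OF that(3,2)] that(1) by presburger
    then show ?thesis by blast
  qed
  ultimately have "infsum ?f (?A \<union> ?B) = 0"
    using infsum_Un_disjoint[OF summ summ, of ?A ?B] A by simp
  moreover have "infsum ?f (?A \<union> ?B) = infsum ?f UNIV"
  proof (rule infsum_cong_neutral)
    fix p assume p: "p \<in> UNIV - (?A \<union> ?B)"
    obtain x y where xy: "p = (x, y)" by (cases p)
    have "chi4 x * chi4 y = 0"
      using p chi4_even[of y] chi4_prod[of x y] by (auto simp: xy)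
    then show "?f p = 0" by (auto simp: xy chi12_def)
  qed auto
  ultimately show ?thesis using infsumI[OF s] by simp
qed

end

section \<open>Theta series of binary quadratic forms\<close>

lemma theta_form_shift: "theta_form a b c q = theta_form a (b + 2 * a * k) (a * k\<^sup>2 + b * k + c) q"
  unfolding theta_form_def
  by (rule infsum_reindex_bij_witness[of _ "\<lambda>(n, m). (n + k * m, m)" "\<lambda>(n, m). (n - k * m, m)"])
    (auto simp: power2_eq_square algebra_simps)

lemma theta_form_swap: "theta_form a b c q = theta_form c b a q"
  unfolding theta_form_def
  by (rule infsum_reindex_bij_witness[of _ "\<lambda>(n, m). (m, n)" "\<lambda>(n, m). (m, n)"])
    (auto simp: algebra_simps)

lemma theta_form_uminus: "theta_form a (- b) c q = theta_form a b c q"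
  unfolding theta_form_def
  by (rule infsum_reindex_bij_witness[of _ "\<lambda>(n, m). (n, - m)" "\<lambda>(n, m). (n, - m)"])
    (auto simp: algebra_simps)

text \<open>All these forms have discriminant -71. The first eight serve the residue weights with a
  = 6, 10, 30; the last six arise from the Hecke operator at 2.\<close>

lemma theta_form_reduce:
  "theta_form 6 1 3 q = theta_form 3 1 6 q" "theta_form 6 5 4 q = theta_form 4 3 5 q"
  "theta_form 10 3 2 q = theta_form 2 1 9 q" "theta_form 10 7 3 q = theta_form 3 1 6 q"
  "theta_form 30 7 1 q = theta_form 1 1 18 q" "theta_form 30 13 2 q = theta_form 2 1 9 q"
  "theta_form 30 17 3 q = theta_form 3 1 6 q" "theta_form 30 23 5 q = theta_form 4 3 5 q"
  "theta_form 6 13 10 q = theta_form 3 1 6 q" "theta_form 12 13 5 q = theta_form 4 3 5 q"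
  "theta_form 3 13 20 q = theta_form 3 1 6 q" "theta_form 4 11 12 q = theta_form 4 3 5 q"
  "theta_form 8 11 6 q = theta_form 3 1 6 q" "theta_form 2 11 24 q = theta_form 2 1 9 q"
proof -
  show 1: "theta_form 6 1 3 q = theta_form 3 1 6 q"
    by (rule theta_form_swap)
  show "theta_form 6 5 4 q = theta_form 4 3 5 q"
    using theta_form_swap[of 6 5 4 q] theta_form_shift[of 4 5 6 q "- 1"] theta_form_uminus[of 4 3 5 q] by simp
  show "theta_form 10 3 2 q = theta_form 2 1 9 q"
    using theta_form_swap[of 10 3 2 q] theta_form_shift[of 2 3 10 q "- 1"] theta_form_uminus[of 2 1 9 q] by simp
  show "theta_form 10 7 3 q = theta_form 3 1 6 q"
    using theta_form_swap[of 10 7 3 q] theta_form_shift[of 3 7 10 q "- 1"] by simp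
  show "theta_form 30 7 1 q = theta_form 1 1 18 q"
    using theta_form_swap[of 30 7 1 q] theta_form_shift[of 1 7 30 q "- 3"] by simp
  show "theta_form 30 13 2 q = theta_form 2 1 9 q"
    using theta_form_swap[of 30 13 2 q] theta_form_shift[of 2 13 30 q "- 3"] by simp
  show "theta_form 30 17 3 q = theta_form 3 1 6 q"
    using theta_form_swap[of 30 17 3 q] theta_form_shift[of 3 17 30 q "- 3"] theta_form_uminus[of 3 1 6 q] by simp
  show "theta_form 30 23 5 q = theta_form 4 3 5 q"
    using theta_form_swap[of 30 23 5 q] theta_form_shift[of 5 23 30 q "- 2"] theta_form_swap[of 5 3 4 q] by simp
  show "theta_form 6 13 10 q = theta_form 3 1 6 q"
    using theta_form_shift[of 6 13 10 q "- 1"] 1 by simp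
  show "theta_form 12 13 5 q = theta_form 4 3 5 q"
    using theta_form_swap[of 12 13 5 q] theta_form_shift[of 5 13 12 q "- 1"] theta_form_swap[of 5 3 4 q] by simp
  show "theta_form 3 13 20 q = theta_form 3 1 6 q"
    using theta_form_shift[of 3 13 20 q "- 2"] by simp
  show "theta_form 4 11 12 q = theta_form 4 3 5 q"
    using theta_form_shift[of 4 11 12 q "- 1"] by simp
  show "theta_form 8 11 6 q = theta_form 3 1 6 q"
    using theta_form_swap[of 8 11 6 q] theta_form_shift[of 6 11 8 q "- 1"] theta_form_uminus[of 6 1 3 q] 1 by simp
  show "theta_form 2 11 24 q = theta_form 2 1 9 q"
    using theta_form_shift[of 2 11 24 q "- 3"] theta_form_uminus[of 2 1 9 q] by simp
qed

text \<open>Supplies fractional powers such as q^(1/24), q^(1/40) and q^(1/120). Any root will do,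
  as only its N-th power enters the final identities.\<close>

lemma complex_root_exists:
  fixes q :: complex
  assumes "q \<noteq> 0" "norm q < 1" "N > 0"
  obtains r where "q = r ^ N" "r \<noteq> 0" "norm r < 1"
proof -
  define r where "r = exp (Ln q / of_nat N)"
  have "r ^ N = q"
    unfolding r_def using assms by (simp flip: exp_of_nat_mult)
  moreover from this have "norm r ^ N < 1"
    using assms by (simp flip: norm_power)
  then have "norm r < 1"
    by (meson not_less one_le_power)
  ultimately show thesis using that[of r] by (simp add: r_def)
qed

lemma summable_on_theta_form:
  fixes q :: complex
  assumes q: "norm q < 1" "q \<noteq> 0" and a: "a > 0" and D: "4 * a * c - b\<^sup>2 > 0"
  shows "(\<lambda>(n, m). q powi (a * n\<^sup>2 + b * n * m + c * m\<^sup>2)) summable_on UNIV"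
proof -
  obtain r where r: "q = r ^ nat (4 * a)" "r \<noteq> 0" "norm r < 1"
    using complex_root_exists[OF q(2,1), of "nat (4 * a)"] a by auto
  let ?j = "\<lambda>(n, m). (2 * a * n + b * m, m)"
  let ?f = "\<lambda>(x, y). r powi (x\<^sup>2 + (4 * a * c - b\<^sup>2) * y\<^sup>2)"
  have "?f summable_on range ?j"
    using summable_on_binary[OF r(3,2) D] summable_on_subset_banach by blast
  moreover have "inj ?j" using a by (auto simp: inj_on_def)
  ultimately have "(?f \<circ> ?j) summable_on UNIV"
    using summable_on_reindex by blast
  moreover have "?f \<circ> ?j = (\<lambda>(n, m). q powi (a * n\<^sup>2 + b * n * m + c * m\<^sup>2))"
  proof
    fix p :: "int \<times> int"
    obtain n m where p: "p = (n, m)" by (cases p)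
    have "(2 * a * n + b * m)\<^sup>2 + (4 * a * c - b\<^sup>2) * m\<^sup>2 = 4 * a * (a * n\<^sup>2 + b * n * m + c * m\<^sup>2)"
      by (simp add: power2_eq_square algebra_simps)
    then show "(?f \<circ> ?j) p = (case p of (n, m) \<Rightarrow> q powi (a * n\<^sup>2 + b * n * m + c * m\<^sup>2))"
      using a r by (simp add: p power_powi)
  qed
  ultimately show ?thesis by simp
qed

text \<open>The action of the Hecke operator at 2.\<close>
lemma theta_form_even_part:
  assumes q: "norm q < 1" "q \<noteq> 0" and a: "a > 0" and D: "16 * a * c - b\<^sup>2 > 0" and b: "odd b"
  shows "theta_form (2 * a) b (2 * c) q + theta_form (2 * a) b (2 * c) (- q)
    = 2 * (theta_form (4 * a) b c (q\<^sup>2) + theta_form a b (4 * c) (q\<^sup>2)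
           - theta_form (2 * a) b (2 * c) (q ^ 4))"
proof -
  define f where "f z = (\<lambda>(n, m). z powi (2 * a * n\<^sup>2 + b * n * m + 2 * c * m\<^sup>2))" for z :: complex
  let ?A = "{(n::int, m::int). even n}" and ?B = "{(n::int, m::int). even m}"
  have f: "f z summable_on A" if "norm z < 1" "z \<noteq> 0" for z A
    using summable_on_theta_form[OF that, of "2 * a" "2 * c" b] a D summable_on_subset_banach
    unfolding f_def by auto
  have A: "infsum (f q) ?A = theta_form (4 * a) b c (q\<^sup>2)"
    unfolding theta_form_def f_def power_powi
    by (rule infsum_reindex_bij_witness[of _ "\<lambda>(n, m). (2 * n, m)" "\<lambda>(n, m). (n div 2, m)"])
      (auto elim!: evenE simp: power2_eq_square algebra_simps)
  have B: "infsum (f q) ?B = theta_form a b (4 * c) (q\<^sup>2)"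
    unfolding theta_form_def f_def power_powi
    by (rule infsum_reindex_bij_witness[of _ "\<lambda>(n, m). (n, 2 * m)" "\<lambda>(n, m). (n, m div 2)"])
      (auto elim!: evenE simp: power2_eq_square algebra_simps)
  have AB: "infsum (f q) (?A \<inter> ?B) = theta_form (2 * a) b (2 * c) (q ^ 4)"
    unfolding theta_form_def f_def power_powi
    by (rule infsum_reindex_bij_witness[of _ "\<lambda>(n, m). (2 * n, 2 * m)" "\<lambda>(n, m). (n div 2, m div 2)"])
      (auto elim!: evenE simp: power2_eq_square algebra_simps)
  have "theta_form (2 * a) b (2 * c) q + theta_form (2 * a) b (2 * c) (- q)
      = (\<Sum>\<^sub>\<infinity>p. f q p + f (- q) p)"
    unfolding infsum_add[OF f[OF q] f[of "- q"], simplified q] theta_form_def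
    using q by (simp add: f_def infsum_add f[unfolded f_def])
  \<comment> \<open>As b is odd, the exponent has the parity of n m. Adding the values at q and -q
    doubles the terms with n or m even and cancels the others.\<close>
  also have "\<dots> = (\<Sum>\<^sub>\<infinity>p\<in>?A \<union> ?B. 2 * f q p)"
  proof (rule infsum_cong_neutral)
    fix p :: "int \<times> int"
    obtain n m where p: "p = (n, m)" by (cases p)
    have "f (- q) p = (if p \<in> ?A \<union> ?B then f q p else - f q p)"
      using b by (auto simp: p f_def power_int_minus_left)
    then show "p \<in> UNIV - (?A \<union> ?B) \<Longrightarrow> f q p + f (- q) p = 0"
      and "p \<in> UNIV \<inter> (?A \<union> ?B) \<Longrightarrow> f q p + f (- q) p = 2 * f q p"
      by auto
  qed auto
  also have "\<dots> = 2 * infsum (f q) (?A \<union> ?B)"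
    by (rule infsum_cmult_right')
  also have "infsum (f q) (?A \<union> ?B) = infsum (f q) ?A + infsum (f q) ?B - infsum (f q) (?A \<inter> ?B)"
    using f[OF q] by (intro infsum_Un_Int) auto
  finally show ?thesis unfolding A B AB .
qed

section \<open>The identities\<close>

text \<open>The triple product with base q^5 at q^3 and q^4 writes G and H through the classes 2, 3
  and 1, 4 modulo 5. Together with one factor E(q^5) these four classes make up E(q).\<close>

lemma RR_G_H_product:
  assumes q: "norm q < 1" "q \<noteq> 0"
  shows "(euler_E q * RR_G q) * (euler_E q * RR_H q) = euler_E q * euler_E (q ^ 5)"
proof -
  have *: "(\<Sum>\<^sub>\<infinity>n. (- 1) powi n * q powi (5 * tri n + int k * n))
      = qpoch_inf (q ^ k) (q ^ 5) * qpoch_inf (q ^ (5 - k)) (q ^ 5) * euler_E (q ^ 5)" if "k \<le> 5" for k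
  proof -
    have "q ^ 5 / q ^ k = q ^ (5 - k)" using q that by (simp add: power_diff)
    moreover have "(- (q ^ k)) powi n * (q ^ 5) powi tri n
        = (- 1) powi n * q powi (5 * tri n + int k * n)" for n
    proof -
      have "(- (q ^ k)) powi n = (- 1) powi n * (q ^ k) powi n"
        by (metis mult_minus1 power_int_mult_distrib)
      then show ?thesis using q by (simp add: power_powi power_int_add)
    qed
    ultimately show ?thesis
      using jacobi_triple_product[of "q ^ 5" "q ^ k"] q
      by (intro infsumI) (simp add: norm_power_less_1)
  qed
  have G: "euler_E q * RR_G q = qpoch_inf (q ^ 3) (q ^ 5) * qpoch_inf (q ^ 2) (q ^ 5) * euler_E (q ^ 5)"
    using *[of 3] rogers_ramanujan_G[OF q] by simp
  have H: "euler_E q * RR_H q = qpoch_inf (q ^ 4) (q ^ 5) * qpoch_inf q (q ^ 5) * euler_E (q ^ 5)"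
    using *[of 4] rogers_ramanujan_H[OF q] by simp
  have "euler_E q = qpoch_inf q (q ^ 5) * qpoch_inf (q ^ 2) (q ^ 5) * qpoch_inf (q ^ 3) (q ^ 5)
      * qpoch_inf (q ^ 4) (q ^ 5) * euler_E (q ^ 5)"
  proof -
    have "{1..5} = {1, 2, 3, 4, 5::nat}" by auto
    then show ?thesis
      using euler_E_multisection[OF q(1), of 5] by (simp add: euler_E_def[of "q ^ 5"] mult.assoc)
  qed
  then show ?thesis unfolding G H by (simp add: mult_ac)
qed

lemma RR_U_1_71: "RR_U 1 71 q = RR_H q * RR_G (q ^ 71) - q ^ 14 * RR_G q * RR_H (q ^ 71)"
  unfolding RR_U_def by simp

lemma theta_316_435:
  assumes q: "norm q < 1" "q \<noteq> 0"
  shows "2 * q ^ 3 * (euler_E q * euler_E (q ^ 71)) = theta_form 3 1 6 q - theta_form 4 3 5 q"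
proof -
  obtain r where r: "q = r ^ 24" "r \<noteq> 0" "norm r < 1"
    using complex_root_exists[OF q(2,1), of 24] by auto
  have "norm (r ^ 71) < 1" using r by (intro norm_power_less_1) auto
  note has_sum_product_residues[OF r(3,2) has_sum_chi12[OF r(3,2)] has_sum_chi12[OF this]]
  then have "((\<lambda>(x, y). of_int (chi12 x * chi12 y) * r powi (x\<^sup>2 + 71 * y\<^sup>2)) has_sum
      2 * (r * euler_E (r ^ 24)) * (2 * (r ^ 71 * euler_E ((r ^ 71) ^ 24)))) UNIV"
    using r by simp
  moreover have "((\<lambda>(x, y). of_int (chi12 x * chi12 y) * r powi (x\<^sup>2 + 71 * y\<^sup>2)) has_sum
      2 * theta_form 3 1 6 q - 2 * theta_form 4 3 5 q) UNIV"
  proof -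
    have 1: "((\<lambda>(x, y). of_int (of_bool (12 dvd x - y) + of_bool (12 dvd x + y)) * r powi (x\<^sup>2 + 71 * y\<^sup>2))
        has_sum 2 * theta_form 3 1 6 q) UNIV"
      using has_sum_theta_residues[OF r(3,2), of 71 6 3 1] by (simp add: theta_form_reduce r(1))
    have 2: "((\<lambda>(x, y). of_int (of_bool (12 dvd x - 5 * y) + of_bool (12 dvd x + 5 * y)) * r powi (x\<^sup>2 + 71 * y\<^sup>2))
        has_sum 2 * theta_form 4 3 5 q) UNIV"
      using has_sum_theta_residues[OF r(3,2), of 71 6 4 5] by (simp add: theta_form_reduce r(1))
    from has_sum_minus[OF 1 2] show ?thesis
      by (simp only: case_prod_unfold chi12_prod of_int_diff left_diff_distrib)
  qed
  ultimately have "2 * (r * euler_E (r ^ 24)) * (2 * (r ^ 71 * euler_E ((r ^ 71) ^ 24)))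
      = 2 * theta_form 3 1 6 q - 2 * theta_form 4 3 5 q"
    by (rule has_sum_unique)
  also have "2 * (r * euler_E (r ^ 24)) * (2 * (r ^ 71 * euler_E ((r ^ 71) ^ 24)))
      = 2 * (2 * (r * r ^ 71) * (euler_E (r ^ 24) * euler_E ((r ^ 71) ^ 24)))"
    by (simp only: mult_ac)
  also have "(r ^ 71) ^ 24 = q ^ 71"
    unfolding r(1) by (simp flip: power_mult)
  \<comment> \<open>The exponent is 1 + 71 = 3 * 24.\<close>
  also have "r * r ^ 71 = q ^ 3"
    unfolding r(1) by (simp flip: power_mult power_Suc)
  finally show ?thesis
    unfolding r(1)[symmetric] right_diff_distrib[symmetric] by (simp only: mult_cancel_left) simp
qed

lemma theta_219_316:
  assumes q: "norm q < 1" "q \<noteq> 0"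
  shows "2 * q\<^sup>2 * (euler_E q * euler_E (q ^ 71)) * RR_U 1 71 q = theta_form 2 1 9 q - theta_form 3 1 6 q"
proof -
  obtain r where r: "q = r ^ 40" "r \<noteq> 0" "norm r < 1"
    using complex_root_exists[OF q(2,1), of 40] by auto
  have R: "norm (r ^ 71) < 1" "r ^ 71 \<noteq> 0" using r by (auto intro: norm_power_less_1)
  let ?g = "\<lambda>q. euler_E q * RR_G q" and ?h = "\<lambda>q. euler_E q * RR_H q"
  let ?w = "\<lambda>(x, y). of_int ((chi4 x * odd5H x) * (chi4 y * odd5G y)
      - (chi4 x * odd5G x) * (chi4 y * odd5H y)) * r powi (x\<^sup>2 + 71 * y\<^sup>2)"
  have "(?w has_sum 2 * (r ^ 9 * ?h (r ^ 40)) * (2 * (r ^ 71 * ?g ((r ^ 71) ^ 40)))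
        - 2 * (r * ?g (r ^ 40)) * (2 * ((r ^ 71) ^ 9 * ?h ((r ^ 71) ^ 40)))) UNIV"
    using has_sum_minus[OF
        has_sum_product_residues[OF r(3,2) has_sum_chi4_odd5H[OF r(3,2)] has_sum_chi4_odd5G[OF R]]
        has_sum_product_residues[OF r(3,2) has_sum_chi4_odd5G[OF r(3,2)] has_sum_chi4_odd5H[OF R]]]
    by (simp only: case_prod_unfold left_diff_distrib of_int_diff of_nat_numeral)
  moreover have "(?w has_sum 2 * theta_form 2 1 9 q - 2 * theta_form 3 1 6 q) UNIV"
  proof -
    have 1: "((\<lambda>(x, y). of_int (of_bool (20 dvd x - 3 * y) + of_bool (20 dvd x + 3 * y)) * r powi (x\<^sup>2 + 71 * y\<^sup>2))
        has_sum 2 * theta_form 2 1 9 q) UNIV"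
      using has_sum_theta_residues[OF r(3,2), of 71 10 2 3] by (simp add: theta_form_reduce r(1))
    have 2: "((\<lambda>(x, y). of_int (of_bool (20 dvd x - 7 * y) + of_bool (20 dvd x + 7 * y)) * r powi (x\<^sup>2 + 71 * y\<^sup>2))
        has_sum 2 * theta_form 3 1 6 q) UNIV"
      using has_sum_theta_residues[OF r(3,2), of 71 10 3 7] by (simp add: theta_form_reduce r(1))
    from has_sum_minus[OF 1 2] show ?thesis
      by (simp only: case_prod_unfold weights_mod_20[symmetric] of_int_diff left_diff_distrib)
  qed
  ultimately have "2 * (r ^ 9 * ?h (r ^ 40)) * (2 * (r ^ 71 * ?g ((r ^ 71) ^ 40)))
        - 2 * (r * ?g (r ^ 40)) * (2 * ((r ^ 71) ^ 9 * ?h ((r ^ 71) ^ 40)))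
      = 2 * theta_form 2 1 9 q - 2 * theta_form 3 1 6 q"
    by (rule has_sum_unique)
  also have "2 * (r ^ 9 * ?h (r ^ 40)) * (2 * (r ^ 71 * ?g ((r ^ 71) ^ 40)))
      = 2 * (2 * (r ^ 9 * r ^ 71) * (?h (r ^ 40) * ?g ((r ^ 71) ^ 40)))"
    by (simp only: mult_ac)
  also have "2 * (r * ?g (r ^ 40)) * (2 * ((r ^ 71) ^ 9 * ?h ((r ^ 71) ^ 40)))
      = 2 * (2 * (r * (r ^ 71) ^ 9) * (?g (r ^ 40) * ?h ((r ^ 71) ^ 40)))"
    by (simp only: mult_ac)
  also have "(r ^ 71) ^ 40 = q ^ 71"
    unfolding r(1) by (simp flip: power_mult)
  \<comment> \<open>The exponents are 9 + 71 = 2 * 40 and 1 + 9 * 71 = 16 * 40; their quotient q^14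
    is the power of q in U(1,71,q).\<close>
  also have "r ^ 9 * r ^ 71 = q\<^sup>2"
    unfolding r(1) by (simp flip: power_mult power_add)
  also have "r * (r ^ 71) ^ 9 = q\<^sup>2 * q ^ 14"
    unfolding r(1) by (simp flip: power_mult power_Suc power_add)
  finally have "2 * (2 * q\<^sup>2 * (?h q * ?g (q ^ 71)) - 2 * (q\<^sup>2 * q ^ 14) * (?g q * ?h (q ^ 71)))
      = 2 * (theta_form 2 1 9 q - theta_form 3 1 6 q)"
    unfolding r(1)[symmetric] right_diff_distrib[symmetric] .
  then have "2 * q\<^sup>2 * (?h q * ?g (q ^ 71)) - 2 * (q\<^sup>2 * q ^ 14) * (?g q * ?h (q ^ 71))
      = theta_form 2 1 9 q - theta_form 3 1 6 q"
    by (simp only: mult_cancel_left) simp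
  then show ?thesis
    unfolding RR_U_1_71 by (simp only: right_diff_distrib mult_ac)
qed

text \<open>The invariance demanded by \<open>hexagonal_cancellation\<close>. It depends only on k
  and y modulo 5. The reflection mixes the two summands, so only their combination is
  invariant.\<close>

lemma hexagonal_weights:
  fixes k y :: int
  shows "sq5 1 (2 * k - y) * odd5H (- y - 2 * k) + sq5 0 (2 * k - y) * odd5G (- y - 2 * k)
      = sq5 1 (y + 4 * k) * odd5H y + sq5 0 (y + 4 * k) * odd5G y"
    and "sq5 4 (2 * k - y) * odd5G (- y - 2 * k) - sq5 0 (2 * k - y) * odd5H (- y - 2 * k)
      = sq5 4 (y + 4 * k) * odd5G y - sq5 0 (y + 4 * k) * odd5H y"
proof -
  obtain K i where k: "k = 5 * K + i" and i: "i = 0 \<or> i = 1 \<or> i = 2 \<or> i = 3 \<or> i = 4"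
    using int_mod_cases(3)[of k] mult_div_mod_eq[of 5 k] by metis
  obtain Y j where y: "y = 5 * Y + j" and j: "j = 0 \<or> j = 1 \<or> j = 2 \<or> j = 3 \<or> j = 4"
    using int_mod_cases(3)[of y] mult_div_mod_eq[of 5 y] by metis
  have res: "(2 * k - y) mod 5 = (2 * i - j) mod 5" "(- y - 2 * k) mod 5 = (- j - 2 * i) mod 5"
    "(y + 4 * k) mod 5 = (j + 4 * i) mod 5" "y mod 5 = j mod 5"
    unfolding k y mod_eq_dvd_iff by (simp_all add: algebra_simps)
  show "sq5 1 (2 * k - y) * odd5H (- y - 2 * k) + sq5 0 (2 * k - y) * odd5G (- y - 2 * k)
      = sq5 1 (y + 4 * k) * odd5H y + sq5 0 (y + 4 * k) * odd5G y"
    unfolding sq5_alt odd5G_def odd5H_def res using i j by (elim disjE) simp_all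
  show "sq5 4 (2 * k - y) * odd5G (- y - 2 * k) - sq5 0 (2 * k - y) * odd5H (- y - 2 * k)
      = sq5 4 (y + 4 * k) * odd5G y - sq5 0 (y + 4 * k) * odd5H y"
    unfolding sq5_alt odd5G_def odd5H_def res using i j by (elim disjE) simp_all
qed

section \<open>The 5-dissection of E\<close>

context
  fixes r :: complex
  assumes r1: "norm r < 1" and r0: "r \<noteq> 0"
begin

definition part5 :: "int \<Rightarrow> complex" where
  "part5 c = (\<Sum>\<^sub>\<infinity>x. of_int (sq5 c x * chi12 x) * r powi x\<^sup>2)"

lemma has_sum_part5: "((\<lambda>x. of_int (sq5 c x * chi12 x) * r powi x\<^sup>2) has_sum part5 c) UNIV"
proof -
  have "(\<lambda>x. of_int (sq5 c x) * (of_int (chi12 x) * r powi x\<^sup>2)) summable_on UNIV"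
    by (rule summable_on_bounded_mult[OF has_sum_imp_summable[OF has_sum_chi12[OF r1 r0]], where K = 1])
      (auto simp: sq5_def)
  then show ?thesis unfolding part5_def by (simp add: mult.assoc)
qed

text \<open>The terms are those with x = 5y, and \<open>chi12 (5 * y) = - chi12 y\<close>. So this
  component is, up to sign, the theta series of E with r^25 in place of r.\<close>

lemma part5_0: "part5 0 = - 2 * r ^ 25 * euler_E (r ^ 600)"
proof -
  have "norm (r ^ 25) < 1" "r ^ 25 \<noteq> 0" using r0 r1 by (auto intro: norm_power_less_1)
  note infsumI[OF has_sum_chi12[OF this]]
  moreover have "part5 0 = (\<Sum>\<^sub>\<infinity>x. - (of_int (chi12 x) * (r ^ 25) powi x\<^sup>2))"
  proof -
    have "part5 0 = (\<Sum>\<^sub>\<infinity>x\<in>{x. 5 dvd x}. of_int (sq5 0 x * chi12 x) * r powi x\<^sup>2)"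
      unfolding part5_def by (rule infsum_cong_neutral) (auto simp: sq5_alt)
    also have "\<dots> = (\<Sum>\<^sub>\<infinity>x. - (of_int (chi12 x) * (r ^ 25) powi x\<^sup>2))"
    proof (rule infsum_reindex_bij_witness[of _ "\<lambda>y. 5 * y" "\<lambda>x. x div 5"])
      fix x :: int assume "x \<in> {x. 5 dvd x}"
      then obtain y where x: "x = 5 * y" by auto
      have "chi4 x = chi4 y" "chi3 x = - chi3 y"
        using chi4_periodic[of y y] chi3_periodic[of "- y" "2 * y"] by (simp_all add: x)
      then show "- (of_int (chi12 (x div 5)) * (r ^ 25) powi (x div 5)\<^sup>2)
          = of_int (sq5 0 x * chi12 x) * r powi x\<^sup>2"
        by (simp add: x chi12_def sq5_alt power_powi power_mult_distrib)
    qed auto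
    finally show ?thesis .
  qed
  ultimately show ?thesis
    by (simp add: infsum_uminus flip: power_mult)
qed

text \<open>With \<open>p = r\<^sup>2\<^sup>4\<close>, this is the classical 5-dissection
  \<open>E(p) = E(p\<^sup>2\<^sup>5) (G/H - p - p\<^sup>2 H/G)\<close>, where \<open>G\<close> and \<open>H\<close> are taken at \<open>p\<^sup>5\<close>.\<close>
lemma part5_1_4:
  fixes g h
  defines "g \<equiv> euler_E (r ^ 120) * RR_G (r ^ 120)" and "h \<equiv> euler_E (r ^ 120) * RR_H (r ^ 120)"
  shows "part5 1 * (r ^ 24 * h) = - (part5 0 * g)" and "part5 4 * g = part5 0 * (r ^ 24 * h)"
proof -
  \<comment> \<open>The base r^3 for y makes x^2 + 3 y^2 the norm form, and 3 * 40 = 5 * 24 places G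
    and H at the fifth power of r^24.\<close>
  have "norm (r ^ 3) < 1" "r ^ 3 \<noteq> 0" using r0 r1 by (auto intro: norm_power_less_1)
  note G = has_sum_chi4_odd5G[OF this] and H = has_sum_chi4_odd5H[OF this]
  note prod = has_sum_product_residues[OF r1 r0 has_sum_part5, where D = 3]
  let ?F = "\<lambda>x y. sq5 1 x * odd5H y + sq5 0 x * odd5G y"
  have "part5 1 * (2 * ((r ^ 3) ^ 9 * (euler_E ((r ^ 3) ^ 40) * RR_H ((r ^ 3) ^ 40))))
      + part5 0 * (2 * (r ^ 3 * (euler_E ((r ^ 3) ^ 40) * RR_G ((r ^ 3) ^ 40)))) = 0"
  proof (rule hexagonal_cancellation[OF r1 r0, of ?F])
    show "?F (2 * k - y) (- y - 2 * k) = ?F (y + 4 * k) y" for k y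
      by (rule hexagonal_weights)
    show "((\<lambda>(x, y). of_int (chi12 x * chi4 y * ?F x y) * r powi (x\<^sup>2 + 3 * y\<^sup>2)) has_sum
      part5 1 * (2 * ((r ^ 3) ^ 9 * (euler_E ((r ^ 3) ^ 40) * RR_H ((r ^ 3) ^ 40))))
      + part5 0 * (2 * (r ^ 3 * (euler_E ((r ^ 3) ^ 40) * RR_G ((r ^ 3) ^ 40))))) UNIV"
      using has_sum_add[OF prod[OF H] prod[OF G]]
      by (rule has_sum_cong[THEN iffD1, rotated]) (auto simp: algebra_simps)
  qed simp
  \<comment> \<open>The two leading powers are r^27 and r^3, so a factor r^24 remains next to
    h.\<close>
  then have "2 * r ^ 3 * (part5 1 * (r ^ 24 * h) + part5 0 * g) = 0"
    unfolding g_def h_def by (simp add: algebra_simps flip: power_mult power_add)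
  then show "part5 1 * (r ^ 24 * h) = - (part5 0 * g)"
    using r0 by (simp add: add_eq_0_iff2)
  let ?F = "\<lambda>x y. sq5 4 x * odd5G y - sq5 0 x * odd5H y"
  have "part5 4 * (2 * (r ^ 3 * (euler_E ((r ^ 3) ^ 40) * RR_G ((r ^ 3) ^ 40))))
      - part5 0 * (2 * ((r ^ 3) ^ 9 * (euler_E ((r ^ 3) ^ 40) * RR_H ((r ^ 3) ^ 40)))) = 0"
  proof (rule hexagonal_cancellation[OF r1 r0, of ?F])
    show "?F (2 * k - y) (- y - 2 * k) = ?F (y + 4 * k) y" for k y
      by (rule hexagonal_weights)
    show "((\<lambda>(x, y). of_int (chi12 x * chi4 y * ?F x y) * r powi (x\<^sup>2 + 3 * y\<^sup>2)) has_sum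
      part5 4 * (2 * (r ^ 3 * (euler_E ((r ^ 3) ^ 40) * RR_G ((r ^ 3) ^ 40))))
      - part5 0 * (2 * ((r ^ 3) ^ 9 * (euler_E ((r ^ 3) ^ 40) * RR_H ((r ^ 3) ^ 40))))) UNIV"
      using has_sum_minus[OF prod[OF G] prod[OF H]]
      by (rule has_sum_cong[THEN iffD1, rotated]) (auto simp: algebra_simps)
  qed simp
  then have "2 * r ^ 3 * (part5 4 * g - part5 0 * (r ^ 24 * h)) = 0"
    unfolding g_def h_def by (simp add: algebra_simps flip: power_mult power_add)
  then show "part5 4 * g = part5 0 * (r ^ 24 * h)"
    using r0 by simp
qed

end

lemma theta_form_combination:
  assumes q: "norm q < 1" "q \<noteq> 0"
  shows "2 * q * (euler_E q * euler_E (q ^ 71)) * (RR_U 1 71 q)\<^sup>2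
    = theta_form 3 1 6 q - theta_form 4 3 5 q - theta_form 2 1 9 q + theta_form 1 1 18 q"
proof -
  obtain r where r: "q = r ^ 120" "r \<noteq> 0" "norm r < 1"
    using complex_root_exists[OF q(2,1), of 120] by auto
  define R where "R = r ^ 71"
  have R: "norm R < 1" "R \<noteq> 0" using r by (auto simp: R_def intro: norm_power_less_1)
  define Q where "Q = q ^ 71"
  have Q: "norm Q < 1" "Q \<noteq> 0" using q by (auto simp: Q_def intro: norm_power_less_1)
  have RQ: "R ^ 120 = Q" unfolding R_def Q_def r(1) by (simp flip: power_mult)
  define p where "p = part5 r"
  define P where "P = part5 R"
  define C where "C = theta_form 3 1 6 q - theta_form 4 3 5 q - theta_form 2 1 9 q + theta_form 1 1 18 q"
  define g where "g = euler_E q * RR_G q"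
  define h where "h = euler_E q * RR_H q"
  define G where "G = euler_E Q * RR_G Q"
  define H where "H = euler_E Q * RR_H Q"
  define z where "z = r ^ 24"
  define e5 where "e5 = euler_E (q ^ 5) * euler_E (Q ^ 5)"
  have sum: "2 * C = - (p 1 * P 4 + p 4 * P 1 + 2 * (p 0 * P 0))"
  proof -
    let ?m = "\<lambda>x y. r powi (x\<^sup>2 + 71 * y\<^sup>2)"
    have 1: "((\<lambda>(x, y). of_int (of_bool (60 dvd x - 17 * y) + of_bool (60 dvd x + 17 * y)) * ?m x y)
        has_sum 2 * theta_form 3 1 6 q) UNIV"
      using has_sum_theta_residues[OF r(3,2), of 71 30 3 17] by (simp add: theta_form_reduce r(1))
    have 2: "((\<lambda>(x, y). of_int (of_bool (60 dvd x - 23 * y) + of_bool (60 dvd x + 23 * y)) * ?m x y)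
        has_sum 2 * theta_form 4 3 5 q) UNIV"
      using has_sum_theta_residues[OF r(3,2), of 71 30 5 23] by (simp add: theta_form_reduce r(1))
    have 3: "((\<lambda>(x, y). of_int (of_bool (60 dvd x - 13 * y) + of_bool (60 dvd x + 13 * y)) * ?m x y)
        has_sum 2 * theta_form 2 1 9 q) UNIV"
      using has_sum_theta_residues[OF r(3,2), of 71 30 2 13] by (simp add: theta_form_reduce r(1))
    have 4: "((\<lambda>(x, y). of_int (of_bool (60 dvd x - 7 * y) + of_bool (60 dvd x + 7 * y)) * ?m x y)
        has_sum 2 * theta_form 1 1 18 q) UNIV"
      using has_sum_theta_residues[OF r(3,2), of 71 30 1 7] by (simp add: theta_form_reduce r(1))
    let ?w = "\<lambda>x y. - ((sq5 1 x * chi12 x) * (sq5 4 y * chi12 y) + (sq5 4 x * chi12 x) * (sq5 1 y * chi12 y)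
          + 2 * ((sq5 0 x * chi12 x) * (sq5 0 y * chi12 y)))"
    from has_sum_add[OF has_sum_minus[OF has_sum_minus[OF 1 2] 3] 4]
    have "((\<lambda>(x, y). of_int (?w x y) * ?m x y) has_sum 2 * theta_form 3 1 6 q - 2 * theta_form 4 3 5 q
          - 2 * theta_form 2 1 9 q + 2 * theta_form 1 1 18 q) UNIV"
      unfolding weights_mod_60[symmetric]
      by (simp only: case_prod_unfold of_int_diff of_int_add[of "_ - _"] left_diff_distrib distrib_right[of "_ - _"])
    moreover have prod: "((\<lambda>(x, y). of_int ((sq5 c x * chi12 x) * (sq5 d y * chi12 y)) * ?m x y)
        has_sum p c * P d) UNIV" for c d
      using has_sum_product_residues[OF r(3,2) has_sum_part5[OF r(3,2), of c]
          has_sum_part5[OF R, of d, unfolded R_def]]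
      by (simp only: p_def P_def R_def of_nat_numeral)
    have "((\<lambda>(x, y). of_int (?w x y) * ?m x y) has_sum - (p 1 * P 4 + p 4 * P 1 + 2 * (p 0 * P 0))) UNIV"
      using has_sum_uminusI[OF has_sum_add[OF has_sum_add[OF prod[of 1 4] prod[of 4 1]]
            has_sum_cmult_right[OF prod[of 0 0], of 2]]]
      by (rule has_sum_cong[THEN iffD1, rotated]) (auto simp: algebra_simps)
    ultimately show ?thesis
      unfolding C_def using has_sum_unique by fastforce
  qed
  have p1: "p 1 * (z * h) = - (p 0 * g)" and p4: "p 4 * g = p 0 * (z * h)"
    using part5_1_4[OF r(3,2)] unfolding p_def z_def g_def h_def r(1) by simp_all
  \<comment> \<open>From 24 * 71 = 24 + 14 * 120.\<close>
  have zR: "R ^ 24 = z * q ^ 14"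
    unfolding R_def z_def r(1) by (simp flip: power_mult power_add)
  have P1: "P 1 * (z * q ^ 14 * H) = - (P 0 * G)" and P4: "P 4 * G = P 0 * (z * q ^ 14 * H)"
    using part5_1_4[OF R] unfolding P_def G_def H_def RQ zR by simp_all
  have p0: "p 0 * P 0 = 4 * q ^ 15 * e5"
  proof -
    have "r ^ 600 = q ^ 5" "R ^ 600 = Q ^ 5" "r ^ 25 * R ^ 25 = q ^ 15"
      unfolding RQ[symmetric] unfolding R_def r(1) by (simp_all flip: power_mult power_add)
    then show ?thesis
      using part5_0[OF r(3,2)] part5_0[OF R] by (simp add: p_def P_def e5_def mult_ac)
  qed
  have gh: "g * h = euler_E q * euler_E (q ^ 5)" and GH: "G * H = euler_E Q * euler_E (Q ^ 5)"
    unfolding g_def h_def G_def H_def using RR_G_H_product q Q by blast+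
  define e where "e = euler_E q * euler_E Q"
  have "z \<noteq> 0" using r by (simp add: z_def)
  have "norm (q ^ 5) < 1" "norm (Q ^ 5) < 1" using q Q by (auto intro: norm_power_less_1)
  then have "e5 \<noteq> 0" "e \<noteq> 0" using q Q by (auto simp: e5_def e_def euler_E_nonzero)
  have U: "h * G - q ^ 14 * g * H = e * RR_U 1 71 q"
    unfolding RR_U_1_71 h_def G_def g_def H_def e_def Q_def by (simp add: algebra_simps)
  \<comment> \<open>The factor e e5 = g h G H lets the four dissection relations be substituted
    without dividing by any value of G or H. It is nonzero and is cancelled at the end.\<close>
  have "2 * C * (z\<^sup>2 * q ^ 14 * (e * e5)) = 2 * C * ((z * h * g) * (z * q ^ 14 * H * G))"
  proof -
    have "e * e5 = (g * h) * (G * H)" unfolding gh GH e_def e5_def by (simp add: mult_ac)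
    then show ?thesis by (simp add: power2_eq_square mult_ac)
  qed
  also have "\<dots> = - ((p 1 * (z * h)) * (P 4 * G) * (g * (z * q ^ 14 * H))
      + (p 4 * g) * (P 1 * (z * q ^ 14 * H)) * (z * h * G)
      + 2 * (p 0 * P 0) * ((z * h * g) * (z * q ^ 14 * H * G)))"
    unfolding sum by (simp add: algebra_simps)
  \<comment> \<open>All three products are now multiples of \<open>p 0 * P 0\<close>: they are the
    two squares and the cross term of (h G - q^14 g H)^2.\<close>
  also have "\<dots> = p 0 * P 0 * z\<^sup>2 * (h * G - q ^ 14 * g * H)\<^sup>2"
    unfolding p1 p4 P1 P4 by (simp add: power2_eq_square algebra_simps)
  also have "\<dots> = 4 * q ^ 15 * e5 * z\<^sup>2 * (e * RR_U 1 71 q)\<^sup>2"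
    unfolding p0 U ..
  also have "\<dots> = 2 * (2 * q * e * (RR_U 1 71 q)\<^sup>2) * (z\<^sup>2 * q ^ 14 * (e * e5))"
  proof -
    have "q ^ 15 = q * q ^ 14" by (simp flip: power_Suc)
    then show ?thesis by (simp only: power2_eq_square) (simp add: mult_ac)
  qed
  finally have "C = 2 * q * e * (RR_U 1 71 q)\<^sup>2"
    using \<open>z \<noteq> 0\<close> \<open>e \<noteq> 0\<close> \<open>e5 \<noteq> 0\<close> q by simp
  then show ?thesis by (simp add: C_def e_def Q_def)
qed

section \<open>The fourth identity\<close>

lemma euler_E_kappa:
  assumes "norm q < 1"
  shows "euler_E q = kappa (- q) * euler_E (q\<^sup>2)"
proof -
  have "{1..2} = {1, 2::nat}" by auto
  then show ?thesis
    using euler_E_multisection[OF assms, of 2] by (simp add: kappa_def euler_E_def[of "q\<^sup>2"])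
qed

lemma kappa_identity:
  assumes q: "norm q < 1" "q \<noteq> 0" and Q: "Q = q ^ 71"
  shows "2 * q * RR_U 1 71 (q\<^sup>2) = - 2 * q ^ 3 + kappa q * kappa Q - kappa (- q) * kappa (- Q)
          - 2 * q ^ 9 * (1 / (kappa (- (q\<^sup>2)) * kappa (- (Q\<^sup>2))))"
proof -
  have Q1: "norm Q < 1" using q by (auto simp: Q intro: norm_power_less_1)
  define e where "e x = euler_E x * euler_E (x ^ 71)" for x
  have pow: "Q ^ k = (q ^ k) ^ 71" for k by (simp add: Q mult.commute flip: power_mult)
  have q2: "norm (q\<^sup>2) < 1" "norm (q ^ 4) < 1" "norm (Q\<^sup>2) < 1" "norm (Q ^ 4) < 1"
    using q Q1 by (auto intro: norm_power_less_1)
  have nz: "e (q\<^sup>2) \<noteq> 0" "e (q ^ 4) \<noteq> 0"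
    unfolding e_def pow[symmetric] using q2 by (auto simp: euler_E_nonzero)
  have minus: "(- q) ^ 71 = - Q" by (simp add: Q)
  \<comment> \<open>After multiplication by e(q^2), every product of values of \<open>kappa\<close>
    becomes a value of e, at q, -q or q^4.\<close>
  have k1: "kappa (- q) * kappa (- Q) * e (q\<^sup>2) = e q"
    using euler_E_kappa[OF q(1)] euler_E_kappa[OF Q1] unfolding e_def pow[symmetric]
    by (simp add: Q mult_ac)
  have k2: "kappa q * kappa Q * e (q\<^sup>2) = e (- q)"
    using euler_E_kappa[of "- q"] euler_E_kappa[of "- Q"] q Q1 unfolding e_def pow[symmetric] minus
    by (simp add: mult_ac)
  have k3: "kappa (- (q\<^sup>2)) * kappa (- (Q\<^sup>2)) * e (q ^ 4) = e (q\<^sup>2)"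
    using euler_E_kappa[OF q2(1)] euler_E_kappa[OF q2(3)] unfolding e_def pow[symmetric]
    by (simp add: mult_ac flip: power_mult)
  have A1: "2 * q ^ 3 * e q = theta_form 3 1 6 q - theta_form 4 3 5 q"
    unfolding e_def by (rule theta_316_435[OF q])
  have A2: "- (2 * q ^ 3 * e (- q)) = theta_form 3 1 6 (- q) - theta_form 4 3 5 (- q)"
    using theta_316_435[of "- q"] q unfolding e_def by simp
  have A3: "2 * q ^ 6 * e (q\<^sup>2) = theta_form 3 1 6 (q\<^sup>2) - theta_form 4 3 5 (q\<^sup>2)"
    using theta_316_435[of "q\<^sup>2"] q q2 unfolding e_def by (simp flip: power_mult)
  have A4: "2 * q ^ 12 * e (q ^ 4) = theta_form 3 1 6 (q ^ 4) - theta_form 4 3 5 (q ^ 4)"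
    using theta_316_435[of "q ^ 4"] q q2 unfolding e_def by (simp flip: power_mult)
  have B: "2 * q ^ 4 * e (q\<^sup>2) * RR_U 1 71 (q\<^sup>2) = theta_form 2 1 9 (q\<^sup>2) - theta_form 3 1 6 (q\<^sup>2)"
    using theta_219_316[of "q\<^sup>2"] q q2 unfolding e_def by (simp flip: power_mult)
  \<comment> \<open>The even-part lemma requires even outer and odd middle coefficients; (6,13,10)
    and (4,11,12) are such representatives of (3,1,6) and (4,3,5).\<close>
  have E1: "theta_form 3 1 6 q + theta_form 3 1 6 (- q)
      = 2 * (theta_form 4 3 5 (q\<^sup>2) + theta_form 3 1 6 (q\<^sup>2) - theta_form 3 1 6 (q ^ 4))"
    using theta_form_even_part[OF q, of 3 5 13] by (simp add: theta_form_reduce)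
  have E2: "theta_form 4 3 5 q + theta_form 4 3 5 (- q)
      = 2 * (theta_form 3 1 6 (q\<^sup>2) + theta_form 2 1 9 (q\<^sup>2) - theta_form 4 3 5 (q ^ 4))"
    using theta_form_even_part[OF q, of 2 6 11] by (simp add: theta_form_reduce)
  \<comment> \<open>In \<open>E1\<close> minus \<open>E2\<close> the series of (3,1,6) at q^2
    cancels. What remains at q^2 is (4,3,5) - (2,1,9), which is minus the sum of \<open>A3\<close>
    and \<open>B\<close>.\<close>
  have "2 * q ^ 3 * e q - 2 * q ^ 3 * e (- q)
      = - 2 * (2 * q ^ 6 * e (q\<^sup>2) + 2 * q ^ 4 * e (q\<^sup>2) * RR_U 1 71 (q\<^sup>2)) - 2 * (2 * q ^ 12 * e (q ^ 4))"
    unfolding A3 A4 B using A1 A2 E1 E2 by algebra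
  moreover have "q ^ 6 = q ^ 3 * q ^ 3" "q ^ 4 = q ^ 3 * q" "q ^ 12 = q ^ 3 * q ^ 9"
    by (simp_all flip: power_add power_Suc2)
  ultimately have "(2 * q ^ 3) * (e q - e (- q))
      = (2 * q ^ 3) * (- 2 * q ^ 3 * e (q\<^sup>2) - 2 * q * RR_U 1 71 (q\<^sup>2) * e (q\<^sup>2) - 2 * q ^ 9 * e (q ^ 4))"
    by algebra
  then have "e q - e (- q) = - 2 * q ^ 3 * e (q\<^sup>2) - 2 * q * RR_U 1 71 (q\<^sup>2) * e (q\<^sup>2) - 2 * q ^ 9 * e (q ^ 4)"
    using q by (simp only: mult_cancel_left) simp
  moreover have "e (q ^ 4) = 1 / (kappa (- (q\<^sup>2)) * kappa (- (Q\<^sup>2))) * e (q\<^sup>2)"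
  proof -
    have "kappa (- (q\<^sup>2)) * kappa (- (Q\<^sup>2)) \<noteq> 0" using k3 nz by force
    then show ?thesis unfolding k3[symmetric] by simp
  qed
  ultimately have "(2 * q * RR_U 1 71 (q\<^sup>2)) * e (q\<^sup>2) = (- 2 * q ^ 3 + kappa q * kappa Q - kappa (- q) * kappa (- Q)
          - 2 * q ^ 9 * (1 / (kappa (- (q\<^sup>2)) * kappa (- (Q\<^sup>2))))) * e (q\<^sup>2)"
    unfolding k1[symmetric] k2[symmetric] by (simp add: algebra_simps)
  then show ?thesis using nz by (simp only: mult_cancel_right) simp
qed

text \<open>By definiteness only the origin has exponent 0. This serves the case q = 0, which is
  excluded elsewhere because roots and negative powers of q occur.\<close>

lemma theta_form_0:
  assumes a: "a > 0" and D: "4 * a * c - b\<^sup>2 > 0"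
  shows "theta_form a b c 0 = 1"
proof -
  have "a * n\<^sup>2 + b * n * m + c * m\<^sup>2 = 0 \<longleftrightarrow> n = 0 \<and> m = 0" for n m
  proof
    assume "a * n\<^sup>2 + b * n * m + c * m\<^sup>2 = 0"
    then have "4 * a * (a * n\<^sup>2 + b * n * m + c * m\<^sup>2) = 0" by simp
    then have *: "(2 * a * n + b * m)\<^sup>2 + (4 * a * c - b\<^sup>2) * m\<^sup>2 = 0"
      by (simp add: power2_eq_square algebra_simps)
    moreover have "(4 * a * c - b\<^sup>2) * m\<^sup>2 \<ge> 0" using D by simp
    ultimately have "(4 * a * c - b\<^sup>2) * m\<^sup>2 = 0"
      using zero_le_power2[of "2 * a * n + b * m"] by linarith
    then have "m = 0" using D by simp
    then show "n = 0 \<and> m = 0" using * a by simp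
  qed auto
  then have "theta_form a b c 0 = (\<Sum>\<^sub>\<infinity>p::int \<times> int. if p = (0, 0) then 1 else 0)"
    unfolding theta_form_def by (intro infsum_cong) (auto simp: power_int_0_left_if split: if_splits)
  also have "\<dots> = (\<Sum>\<^sub>\<infinity>p\<in>{(0::int, 0::int)}. 1)"
    by (rule infsum_cong_neutral) auto
  finally show ?thesis by simp
qed

theorem theorem4p3:
  fixes q Q :: complex
  assumes "norm q < 1" and "Q = q ^ 71"
  shows "2 * q ^ 3 * euler_E q * euler_E Q = theta_form 3 1 6 q - theta_form 4 3 5 q
    \<and> 2 * q * euler_E q * euler_E Q * (RR_U 1 71 q)\<^sup>2
        = theta_form 3 1 6 q - theta_form 4 3 5 q - theta_form 2 1 9 q + theta_form 1 1 18 q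
    \<and> 2 * q\<^sup>2 * euler_E q * euler_E Q * RR_U 1 71 q = theta_form 2 1 9 q - theta_form 3 1 6 q
    \<and> 2 * q * RR_U 1 71 (q\<^sup>2)
        = - 2 * q ^ 3 + kappa q * kappa Q - kappa (- q) * kappa (- Q)
          - 2 * q ^ 9 * (1 / (kappa (- (q\<^sup>2)) * kappa (- (Q\<^sup>2))))
    \<and> (theta_form 3 1 6 q - theta_form 4 3 5 q - theta_form 2 1 9 q + theta_form 1 1 18 q)
          * (theta_form 3 1 6 q - theta_form 4 3 5 q)
        = (theta_form 2 1 9 q - theta_form 3 1 6 q)\<^sup>2"
proof (cases "q = 0")
  case True
  \<comment> \<open>At q = 0 all theta series equal 1, and both sides of each identity
    vanish.\<close>
  then show ?thesis by (simp add: assms(2) theta_form_0)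
next
  case False
  define e where "e = euler_E q * euler_E Q"
  have 1: "2 * q ^ 3 * e = theta_form 3 1 6 q - theta_form 4 3 5 q"
    unfolding e_def assms(2) by (rule theta_316_435[OF assms(1) False])
  have 2: "2 * q * e * (RR_U 1 71 q)\<^sup>2
      = theta_form 3 1 6 q - theta_form 4 3 5 q - theta_form 2 1 9 q + theta_form 1 1 18 q"
    unfolding e_def assms(2) by (rule theta_form_combination[OF assms(1) False])
  have 3: "2 * q\<^sup>2 * e * RR_U 1 71 q = theta_form 2 1 9 q - theta_form 3 1 6 q"
    unfolding e_def assms(2) by (rule theta_219_316[OF assms(1) False])
  have "(2 * q * e * (RR_U 1 71 q)\<^sup>2) * (2 * q ^ 3 * e) = (2 * q\<^sup>2 * e * RR_U 1 71 q)\<^sup>2"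
    by (simp add: power2_eq_square power3_eq_cube mult_ac)
  note 5 = this[unfolded 1 2 3]
  show ?thesis
    using 1 2 3 5 kappa_identity[OF assms(1) False assms(2)]
    unfolding e_def mult.assoc[symmetric] by (intro conjI)
qed

end
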